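(* Let $\bm{A}\in\mathbb{R}^{m\times n}$, $\bm{b}\in\mathbb{R}^m$, $\alpha\in(0,1)$, $\lambda>0$, $\gamma\in(0,1)$, and let $\{\bm{x}_k\}$ be a sequence generated by DCEN-DCA (see context) for minimizing $\mathcal{H}=g-h$. If $$\left(-\bm{A}^\top\bm{b}+\partial(\lambda\gamma\|\cdot\|_1)(\bm{0})\right)\cap\partial(\lambda\alpha\gamma\|\cdot\|_2)(\bm{0})=\emptyset,$$ then: (a) $\lim_{k\to\infty}\operatorname{dist}(\bm{0},\partial\mathcal{H}(\bm{x}_k))=0$; (b) the sequence $\{\bm{x}_k\}$ converges to a stationary point of $\mathcal{H}$, and $\sum_{k=1}^\infty\|\bm{x}_k-\bm{x}_{k-1}\|_2<\infty$.
   Context: Define $g(\bm{x})=\frac12\|\bm{A}\bm{x}-\bm{b}\|_2^2+\lambda\left(\gamma\|\bm{x}\|_1+\frac{3(1-\gamma)}{2}\|\bm{x}\|_2^2\right)$, $h(\bm{x})=\lambda\left(\alpha\gamma\|\bm{x}\|_2+\frac{1-\gamma}{2}\|\bm{x}\|_2^2\right)$, and $\mathcal{H}=g-h$, i.e. $\mathcal{H}(\bm{x})=\frac12\|\bm{A}\bm{x}-\bm{b}\|_2^2+\lambda\left(\gamma(\|\bm{x}\|_1-\alpha\|\bm{x}\|_2)+(1-\gamma)\|\bm{x}\|_2^2\right)$. DCEN-DCA: from an arbitrary $\bm{x}_0\in\mathbb{R}^n$, with every subproblem solved exactly, $\bm{x}_{k+1}=\arg\min_{\bm{x}\in\mathbb{R}^n}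 g(\bm{x})$ if $\bm{x}_k=\bm{0}$, and $\bm{x}_{k+1}=\arg\min_{\bm{x}\in\mathbb{R}^n}\{g(\bm{x})-\lambda\langle\bm{x},\bm{d}_{\ell_2}(\bm{x}_k)\rangle\}$ otherwise, where $\bm{d}_{\ell_2}(\bm{x})=\left(\frac{\alpha\gamma}{\|\bm{x}\|_2}+1-\gamma\right)\bm{x}$ for $\bm{x}\ne\bm{0}$. $\partial g,\partial h$ are convex subdifferentials, and $\partial\mathcal{H}(\bm{x}):=\partial g(\bm{x})-\partial h(\bm{x})=\{\bm{u}-\bm{v}:\bm{u}\in\partial g(\bm{x}),\bm{v}\in\partial h(\bm{x})\}$. A stationary point of $\mathcal{H}$ is a point $\bm{x}$ with $\bm{0}\in\partial\mathcal{H}(\bm{x})$. *)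

theory Defs
  imports "HOL-Analysis.Analysis"
begin

definition l1_norm :: "real ^ 'n \<Rightarrow> real" where
  "l1_norm x = (\<Sum>i\<in>UNIV. \<bar>x $ i\<bar>)"

definition subdifferential :: "('a::real_inner \<Rightarrow> real) \<Rightarrow> 'a \<Rightarrow> 'a set" where
  "subdifferential f x = {v. \<forall>y. f y \<ge> f x + v \<bullet> (y - x)}"

(* The subdifferential of a difference g - h depends on the chosen decomposition, so it takes
   both convex parts as arguments. *)
definition dc_subdifferential ::
    "('a::real_inner \<Rightarrow> real) \<Rightarrow> ('a \<Rightarrow> real) \<Rightarrow> 'a \<Rightarrow> 'a set" where
  "dc_subdifferential g h x = {u - v | u v. u \<in> subdifferential g x \<and> v \<in> subdifferential h x}"

definition dcen_g ::
    "real ^ 'n ^ 'm \<Rightarrow> real ^ 'm \<Rightarrow> real \<Rightarrow> real \<Rightarrow> real ^ 'n \<Rightarrow> real" where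
  "dcen_g A b lam \<gamma> x =
     1/2 * (norm (A *v x - b))\<^sup>2 + lam * (\<gamma> * l1_norm x + 3 * (1 - \<gamma>) / 2 * (norm x)\<^sup>2)"

definition dcen_h :: "real \<Rightarrow> real \<Rightarrow> real \<Rightarrow> real ^ 'n \<Rightarrow> real" where
  "dcen_h lam \<alpha> \<gamma> x = lam * (\<alpha> * \<gamma> * norm x + (1 - \<gamma>) / 2 * (norm x)\<^sup>2)"

definition dcen_H ::
    "real ^ 'n ^ 'm \<Rightarrow> real ^ 'm \<Rightarrow> real \<Rightarrow> real \<Rightarrow> real \<Rightarrow> real ^ 'n \<Rightarrow> real" where
  "dcen_H A b lam \<alpha> \<gamma> x =
     1/2 * (norm (A *v x - b))\<^sup>2
       + lam * (\<gamma> * (l1_norm x - \<alpha> * norm x) + (1 - \<gamma>) * (norm x)\<^sup>2)"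

lemma dcen_H_eq_diff: "dcen_H A b lam \<alpha> \<gamma> x = dcen_g A b lam \<gamma> x - dcen_h lam \<alpha> \<gamma> x"
  unfolding dcen_H_def dcen_g_def dcen_h_def by (simp add: field_simps)

(* Never empty, since g and h are finite convex functions for lam >= 0, \<alpha> >= 0 and 0 <= \<gamma> <= 1;
   so infdist 0 of it is the genuine distance and not the value 0 given to the empty set. *)
definition dcen_subdiff_H ::
    "real ^ 'n ^ 'm \<Rightarrow> real ^ 'm \<Rightarrow> real \<Rightarrow> real \<Rightarrow> real \<Rightarrow> real ^ 'n \<Rightarrow> (real ^ 'n) set" where
  "dcen_subdiff_H A b lam \<alpha> \<gamma> = dc_subdifferential (dcen_g A b lam \<gamma>) (dcen_h lam \<alpha> \<gamma>)"

definition dcen_stationary ::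
    "real ^ 'n ^ 'm \<Rightarrow> real ^ 'm \<Rightarrow> real \<Rightarrow> real \<Rightarrow> real \<Rightarrow> real ^ 'n \<Rightarrow> bool" where
  "dcen_stationary A b lam \<alpha> \<gamma> x \<longleftrightarrow> 0 \<in> dcen_subdiff_H A b lam \<alpha> \<gamma> x"

(* Only used at nonzero points. *)
definition d_l2 :: "real \<Rightarrow> real \<Rightarrow> real ^ 'n \<Rightarrow> real ^ 'n" where
  "d_l2 \<alpha> \<gamma> x = (\<alpha> * \<gamma> / norm x + 1 - \<gamma>) *\<^sub>R x"

(* The starting point x 0 is unconstrained. For lam > 0 and \<gamma> < 1 the subproblems are strongly
   convex, so their minimizers exist and are unique. *)
definition dcen_dca_sequence ::
    "real ^ 'n ^ 'm \<Rightarrow> real ^ 'm \<Rightarrow> real \<Rightarrow> real \<Rightarrow> real \<Rightarrow> (nat \<Rightarrow> real ^ 'n) \<Rightarrow> bool" where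
  "dcen_dca_sequence A b lam \<alpha> \<gamma> x \<longleftrightarrow>
     (\<forall>k. if x k = 0
          then is_arg_min (dcen_g A b lam \<gamma>) (\<lambda>_. True) (x (Suc k))
          else is_arg_min (\<lambda>y. dcen_g A b lam \<gamma> y - lam * (y \<bullet> d_l2 \<alpha> \<gamma> (x k)))
                 (\<lambda>_. True) (x (Suc k)))"

end

theory Submission
  imports Defs "HOL-Computational_Algebra.Polynomial"
begin

text \<open>Strong convexity of $h$ makes $\mathcal{H}$ decrease along the iterates by a multiple of
  $\|x_{k+1} - x_k\|^2$, and since $0$ is not stationary the iterates stay away from $0$, where
  $\nabla h$ is Lipschitz and thus $\|\partial\mathcal{H}(x_{k+1})\|$ is controlled by
  $\|x_{k+1} - x_k\|$. Convergence then follows from a Lojasiewicz inequality for $\mathcal{H}$ at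
  nonzero points. That inequality is obtained without semialgebraic geometry: on each face of fixed sign
  pattern $\mathcal{H}$ is a positive definite quadratic function minus $c \|x\|$, and in an eigenbasis
  of the quadratic part the equation $\nabla f(x) = w$ with $s = c / \|x\|$ reduces to a rational
  secular equation in the single variable $s$, as for the trust region subproblem.\<close>

section \<open>Orthonormal eigenbases\<close>

text \<open>The inequality takes the form \<open>F \<le> e powr (1 + \<eta>)\<close> for all small
  \<open>\<eta>\<close>, where one \<open>\<eta>\<close> is at once the radius around z, the bound
  on the gradient size e and the gain in the exponent. Being eventual in \<open>\<eta>\<close>, it
  holds for finitely many sign patterns simultaneously as soon as it holds for each. The nonsmooth
  term does no harm on a face: a subgradient of g is determined in the directions tangent to the
  face, and its normal part can only enlarge the norm on the right-hand side. Two obstacles shape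
  the smooth part. A coordinate whose eigenvalue equals \<open>c / norm z\<close> cannot be read off
  from the gradient, since its coefficient there vanishes; the total squared mass of such
  coordinates is therefore kept as an extra unknown and eliminated between the equation for the
  value and the equation for the norm. Moreover the rational function must not vanish identically;
  this is settled by positive eigenvalues, which the term
  \<open>lam * (1 - \<gamma>) * (norm x)\<^sup>2\<close> guarantees even when A has a
  kernel.\<close>

lemma linear_coefficient_zero:
  fixes a q \<tau> :: real
  assumes "\<tau> > 0" and nonneg: "\<And>t. \<bar>t\<bar> < \<tau> \<Longrightarrow> t * a + t\<^sup>2 * q \<ge> 0"
  shows "a = 0"
proof -
  have "((\<lambda>t. t * a + t\<^sup>2 * q) has_real_derivative a) (at 0)"
    by (auto intro!: derivative_eq_intros)
  moreover have "\<forall>t. \<bar>0 - t\<bar> < \<tau> \<longrightarrow> 0 * a + 0\<^sup>2 * q \<le> t * a + t\<^sup>2 * q"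
    using nonneg by auto
  ultimately show ?thesis
    using DERIV_local_min \<open>\<tau> > 0\<close> by blast
qed

text \<open>A maximizer b of the Rayleigh quotient on the unit sphere of V works: comparing b with
  \<open>b + t *\<^sub>R y\<close> for both signs of t shows that
  \<open>\<mu> *\<^sub>R b - T b\<close> is orthogonal to V, and this vector itself lies in
  V.\<close>

lemma self_adjoint_eigenvector:
  fixes T :: "'a::euclidean_space \<Rightarrow> 'a"
  assumes "linear T" and V: "subspace V" and inv: "\<And>x. x \<in> V \<Longrightarrow> T x \<in> V"
    and adj: "\<And>x y. x \<in> V \<Longrightarrow> y \<in> V \<Longrightarrow> T x \<bullet> y = x \<bullet> T y"
    and "V \<noteq> {0}"
  obtains b \<mu> where "b \<in> V" "norm b = 1" "T b = \<mu> *\<^sub>R b"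
proof -
  interpret T: linear T by fact
  obtain a where a: "a \<in> V" "a \<noteq> 0"
    using \<open>V \<noteq> {0}\<close> V subspace_0 by blast
  have "a /\<^sub>R norm a \<in> V \<inter> sphere 0 1"
    using a V by (simp add: subspace_scale)
  moreover have "compact (V \<inter> sphere 0 1)"
    by (simp add: closed_Int_compact closed_subspace V)
  moreover have "continuous_on (V \<inter> sphere 0 1) (\<lambda>x. x \<bullet> T x)"
    using linear_continuous_on[of T] \<open>linear T\<close>
    by (auto intro!: continuous_on_inner continuous_on_id simp: linear_conv_bounded_linear)
  ultimately obtain b where b: "b \<in> V \<inter> sphere 0 1"
    and max: "\<And>x. x \<in> V \<inter> sphere 0 1 \<Longrightarrow> x \<bullet> T x \<le> b \<bullet> T b"
    using continuous_attains_sup[of "V \<inter> sphere 0 1" "\<lambda>x. x \<bullet> T x"] by blast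
  define \<mu> where "\<mu> = b \<bullet> T b"
  have Q: "x \<bullet> T x \<le> \<mu> * (x \<bullet> x)" if "x \<in> V" for x
  proof (cases "x = 0")
    case False
    have "x /\<^sub>R norm x \<in> V \<inter> sphere 0 1"
      using that V False by (simp add: subspace_scale)
    from max[OF this] have "(x \<bullet> T x) / (norm x)\<^sup>2 \<le> \<mu>"
      by (simp add: T.scale \<mu>_def power2_eq_square divide_simps)
    then show ?thesis
      using False by (simp add: power2_norm_eq_inner divide_simps)
  qed (simp add: T.zero)
  have bb: "b \<bullet> b = 1" "b \<in> V" using b by (auto simp: dot_square_norm)
  have orth: "(\<mu> *\<^sub>R b - T b) \<bullet> y = 0" if "y \<in> V" for y
  proof -
    have "t * (2 * ((\<mu> *\<^sub>R b - T b) \<bullet> y)) + t\<^sup>2 * (\<mu> * (y \<bullet> y) - y \<bullet> T y) \<ge> 0" for t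
    proof -
      have "b + t *\<^sub>R y \<in> V"
        using V bb that by (simp add: subspace_add subspace_scale)
      from Q[OF this] show ?thesis
        using bb adj[OF \<open>b \<in> V\<close> that] \<mu>_def
        by (simp add: T.add T.scale inner_simps inner_commute algebra_simps power2_eq_square)
    qed
    then have "2 * ((\<mu> *\<^sub>R b - T b) \<bullet> y) = 0"
      by (rule linear_coefficient_zero[of 1, rotated]) auto
    then show ?thesis by simp
  qed
  have "\<mu> *\<^sub>R b - T b \<in> V"
    using V bb inv by (simp add: subspace_diff subspace_scale)
  from orth[OF this] have "T b = \<mu> *\<^sub>R b" by simp
  with that bb show ?thesis by (simp add: norm_eq_1)
qed

text \<open>Induction on the dimension: the complement of an eigenvector inside V is again
  invariant. Symmetry is demanded on V alone because the operator of interest is a Hessian followed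
  by a coordinate projection, which is symmetric only on the range of that projection.\<close>

lemma self_adjoint_eigenbasis:
  fixes T :: "'a::euclidean_space \<Rightarrow> 'a"
  assumes T: "linear T" and V: "subspace V" and inv: "\<And>x. x \<in> V \<Longrightarrow> T x \<in> V"
    and adj: "\<And>x y. x \<in> V \<Longrightarrow> y \<in> V \<Longrightarrow> T x \<bullet> y = x \<bullet> T y"
  shows "\<exists>B \<mu>. pairwise orthogonal B \<and> span B = V \<and> (\<forall>b\<in>B. norm b = 1 \<and> T b = \<mu> b *\<^sub>R b)"
  using V inv adj
proof (induction "dim V" arbitrary: V rule: less_induct)
  case (less V)
  interpret T: linear T by fact
  show ?case
  proof (cases "V = {0}")
    case True
    then show ?thesis by (intro exI[of _ "{}"]) auto
  next
    case False
    then obtain b \<mu>b where b: "b \<in> V" "norm b = 1" "T b = \<mu>b *\<^sub>R b"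
      using self_adjoint_eigenvector[OF T] less.prems by metis
    define W where "W = {x \<in> V. x \<bullet> b = 0}"
    have W: "subspace W"
      using less.prems(1) unfolding W_def subspace_def by (simp add: inner_simps)
    have "W \<subseteq> V" "b \<notin> W" using b by (auto simp: W_def norm_eq_1)
    then have "W \<subset> V" using b(1) by blast
    then have "dim W < dim V"
      using W less.prems(1) by (metis dim_psubset span_eq_iff)
    moreover have "T x \<in> W" if "x \<in> W" for x
      using that less.prems(2) less.prems(3)[of x b] b by (auto simp: W_def)
    moreover have "T x \<bullet> y = x \<bullet> T y" if "x \<in> W" "y \<in> W" for x y
      using that less.prems(3) by (simp add: W_def)
    ultimately obtain B \<mu> where B: "pairwise orthogonal B" "span B = W"
      "\<forall>v\<in>B. norm v = 1 \<and> T v = \<mu> v *\<^sub>R v"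
      using less.hyps[OF _ W] by blast
    have BW: "v \<in> W" if "v \<in> B" for v using B(2) that span_base by blast
    have "b \<notin> B" using BW b by (auto simp: W_def norm_eq_1)
    have "pairwise orthogonal (insert b B)"
      using B(1) BW by (auto simp: pairwise_insert orthogonal_def W_def inner_commute)
    moreover have "span (insert b B) = V"
    proof
      show "span (insert b B) \<subseteq> V"
        using BW b less.prems(1) by (intro span_minimal) (auto simp: W_def)
      show "V \<subseteq> span (insert b B)"
      proof
        fix x assume "x \<in> V"
        then have "x - (x \<bullet> b) *\<^sub>R b \<in> W"
          using b less.prems(1)
          by (auto simp: W_def inner_simps norm_eq_1 subspace_diff subspace_scale)
        then show "x \<in> span (insert b B)"
          using B(2) by (metis span_breakdown_eq)
      qed
    qed
    moreover have "\<forall>v\<in>insert b B. norm v = 1 \<and> T v = (\<mu>(b := \<mu>b)) v *\<^sub>R v"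
      using B(3) b \<open>b \<notin> B\<close> by auto
    ultimately show ?thesis by blast
  qed
qed

lemma orthonormal_coordinates:
  fixes x :: "'a::euclidean_space"
  assumes "pairwise orthogonal B" "\<And>b. b \<in> B \<Longrightarrow> norm b = 1" "x \<in> span B"
  shows "finite B" and "x = (\<Sum>b\<in>B. (b \<bullet> x) *\<^sub>R b)"
    and "(norm x)\<^sup>2 = (\<Sum>b\<in>B. (b \<bullet> x)\<^sup>2)"
proof -
  have "0 \<notin> B" using assms(2) by force
  then show fin: "finite B"
    using assms(1) pairwise_orthogonal_independent independent_imp_finite by blast
  have orth: "(x - (\<Sum>b\<in>B. (b \<bullet> x) *\<^sub>R b)) \<bullet> y = 0" if "y \<in> B" for y
  proof -
    have "(\<Sum>b\<in>B. (b \<bullet> x) *\<^sub>R b) \<bullet> y = (\<Sum>b\<in>B. if b = y then b \<bullet> x else 0)"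
      unfolding inner_sum_left using assms(1,2) that
      by (intro sum.cong refl) (auto simp: pairwise_def orthogonal_def norm_eq_1)
    then show ?thesis using fin that by (simp add: inner_simps inner_commute)
  qed
  have "x - (\<Sum>b\<in>B. (b \<bullet> x) *\<^sub>R b) \<in> span B"
    by (intro span_diff assms(3) span_sum span_scale span_base)
  then have "orthogonal (x - (\<Sum>b\<in>B. (b \<bullet> x) *\<^sub>R b)) (x - (\<Sum>b\<in>B. (b \<bullet> x) *\<^sub>R b))"
    by (rule orthogonal_to_span) (simp add: orthogonal_def orth)
  then have "x - (\<Sum>b\<in>B. (b \<bullet> x) *\<^sub>R b) = 0"
    by (simp only: orthogonal_self)
  then show rep: "x = (\<Sum>b\<in>B. (b \<bullet> x) *\<^sub>R b)"
    by (rule iffD2[OF eq_iff_diff_eq_0])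
  have "x \<bullet> x = x \<bullet> (\<Sum>b\<in>B. (b \<bullet> x) *\<^sub>R b)"
    by (rule arg_cong[OF rep, of "(\<bullet>) x"])
  also have "\<dots> = (\<Sum>b\<in>B. (b \<bullet> x)\<^sup>2)"
    by (simp add: inner_sum_right power2_eq_square inner_commute)
  finally show "(norm x)\<^sup>2 = (\<Sum>b\<in>B. (b \<bullet> x)\<^sup>2)"
    by (simp add: power2_norm_eq_inner)
qed

section \<open>Growth rates of scalar functions\<close>

text \<open>The point is that one exponent N serves both bounds. Where \<open>\<psi>\<close> does
  not vanish, N = 1 works by differentiability; at a zero, N is the order of the root of the
  numerator, and \<open>\<psi>\<close> is \<open>(s - s0) ^ N\<close> times a factor bounded above
  and away from 0.\<close>

lemma rational_order_bounds:
  fixes \<psi> d :: "real \<Rightarrow> real" and q :: "real poly"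
  assumes "q \<noteq> 0" and der: "(\<psi> has_real_derivative \<psi>') (at s0)"
    and d: "isCont d s0" "d s0 \<noteq> 0"
    and q: "\<forall>\<^sub>F s in nhds s0. \<psi> s * d s = poly q s"
  shows "\<exists>N\<ge>1. \<exists>C. \<exists>c>0. \<forall>\<^sub>F s in nhds s0.
           \<bar>\<psi> s - \<psi> s0\<bar> \<le> C * \<bar>s - s0\<bar> ^ N \<and> c * \<bar>s - s0\<bar> ^ N \<le> \<bar>\<psi> s\<bar>"
proof (cases "\<psi> s0 = 0")
  case False
  have "((\<lambda>s. \<bar>(\<psi> s - \<psi> s0) / (s - s0)\<bar>) \<longlongrightarrow> \<bar>\<psi>'\<bar>) (at s0)"
    using der by (intro tendsto_rabs) (simp add: has_field_derivative_iff)
  then have "\<forall>\<^sub>F s in at s0. \<bar>(\<psi> s - \<psi> s0) / (s - s0)\<bar> < \<bar>\<psi>'\<bar> + 1"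
    by (rule order_tendstoD) simp
  then have lip: "\<forall>\<^sub>F s in nhds s0. \<bar>\<psi> s - \<psi> s0\<bar> \<le> (\<bar>\<psi>'\<bar> + 1) * \<bar>s - s0\<bar> ^ 1"
    unfolding eventually_at_filter by eventually_elim (auto simp: field_simps)
  have "isCont \<psi> s0" using der DERIV_isCont by blast
  then have "((\<lambda>s. \<bar>\<psi> s\<bar>) \<longlongrightarrow> \<bar>\<psi> s0\<bar>) (nhds s0)"
    by (intro tendsto_rabs) (simp add: continuous_at tendsto_at_iff_tendsto_nhds)
  then have "\<forall>\<^sub>F s in nhds s0. \<bar>\<psi> s0\<bar> / 2 < \<bar>\<psi> s\<bar>"
    by (rule order_tendstoD) (use False in simp)
  moreover have "\<forall>\<^sub>F s in nhds s0. \<bar>s - s0\<bar> < 1"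
    using eventually_nhds_metric[of "\<lambda>s. \<bar>s - s0\<bar> < 1" s0]
    by (auto simp: dist_real_def intro: exI[of _ 1])
  ultimately have "\<forall>\<^sub>F s in nhds s0. \<bar>\<psi> s0\<bar> / 2 * \<bar>s - s0\<bar> ^ 1 \<le> \<bar>\<psi> s\<bar>"
  proof eventually_elim
    case (elim s)
    have "\<bar>\<psi> s0\<bar> / 2 * \<bar>s - s0\<bar> ^ 1 \<le> \<bar>\<psi> s0\<bar> / 2 * 1"
      using elim by (intro mult_left_mono) auto
    then show ?case using elim by simp
  qed
  with lip have "\<forall>\<^sub>F s in nhds s0. \<bar>\<psi> s - \<psi> s0\<bar> \<le> (\<bar>\<psi>'\<bar> + 1) * \<bar>s - s0\<bar> ^ 1 \<and>
      \<bar>\<psi> s0\<bar> / 2 * \<bar>s - s0\<bar> ^ 1 \<le> \<bar>\<psi> s\<bar>"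
    by (rule eventually_conj)
  with False show ?thesis
    by (intro exI[of _ "1::nat"] conjI exI[of _ "\<bar>\<psi>'\<bar> + 1"] exI[of _ "\<bar>\<psi> s0\<bar> / 2"]) auto
next
  case True
  define N where "N = order s0 q"
  obtain q2 where q2: "q = [:- s0, 1:] ^ N * q2" "\<not> [:- s0, 1:] dvd q2"
    using order_decomp[OF \<open>q \<noteq> 0\<close>] unfolding N_def by blast
  have "poly q s0 = 0"
    using eventually_nhds_x_imp_x[OF q] True by simp
  then have N: "N \<ge> 1"
    using \<open>q \<noteq> 0\<close> order_root[of q s0] by (auto simp: N_def)
  define k where "k s = poly q2 s / d s" for s
  have k0: "k s0 \<noteq> 0" using q2(2) d by (simp add: k_def poly_eq_0_iff_dvd)
  have dt: "(d \<longlongrightarrow> d s0) (nhds s0)"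
    using d(1) by (simp add: continuous_at tendsto_at_iff_tendsto_nhds)
  have "((\<lambda>s. \<bar>k s\<bar>) \<longlongrightarrow> \<bar>k s0\<bar>) (nhds s0)"
    unfolding k_def
    by (intro tendsto_intros dt d poly_isCont[unfolded continuous_at, THEN tendsto_at_iff_tendsto_nhds[THEN iffD1]])
  then have "\<forall>\<^sub>F s in nhds s0. \<bar>k s0\<bar> / 2 < \<bar>k s\<bar>" "\<forall>\<^sub>F s in nhds s0. \<bar>k s\<bar> < 2 * \<bar>k s0\<bar>"
    using k0 by (auto intro: order_tendstoD(1)[of _ "\<bar>k s0\<bar>"] order_tendstoD(2)[of _ "\<bar>k s0\<bar>"]
        simp del: less_divide_eq_numeral1 divide_less_eq_numeral1)
  moreover have "\<forall>\<^sub>F s in nhds s0. d s \<noteq> 0"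
    using dt d(2) by (rule tendsto_imp_eventually_ne)
  ultimately have "\<forall>\<^sub>F s in nhds s0. \<bar>\<psi> s - \<psi> s0\<bar> \<le> 2 * \<bar>k s0\<bar> * \<bar>s - s0\<bar> ^ N \<and>
      \<bar>k s0\<bar> / 2 * \<bar>s - s0\<bar> ^ N \<le> \<bar>\<psi> s\<bar>"
    using q
  proof eventually_elim
    case (elim s)
    then have "\<psi> s = poly q s / d s" by (simp add: field_simps)
    also have "\<dots> = (s - s0) ^ N * k s"
      unfolding k_def q2(1) by (simp add: poly_power)
    finally have "\<bar>\<psi> s\<bar> = \<bar>k s\<bar> * \<bar>s - s0\<bar> ^ N"
      by (simp add: abs_mult power_abs)
    moreover have "\<bar>k s0\<bar> / 2 * \<bar>s - s0\<bar> ^ N \<le> \<bar>k s\<bar> * \<bar>s - s0\<bar> ^ N"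
      using elim by (intro mult_right_mono) auto
    ultimately show ?case
      using elim True by (auto intro!: mult_right_mono)
  qed
  then show ?thesis
    using N k0 by (intro exI[of _ N] conjI exI[of _ "2 * \<bar>k s0\<bar>"] exI[of _ "\<bar>k s0\<bar> / 2"]) auto
qed

text \<open>Here t stands for \<open>s - s0\<close>, e for the size of the gradient and
  \<open>\<Delta>\<close> for the difference of function values. The balance hypothesis forces
  \<open>\<bar>t\<bar> ^ (2 * N + 1)\<close> to be of order \<open>e\<^sup>2\<close>, so that the
  leading term \<open>\<bar>t\<bar> ^ Suc N\<close> has order e to the power
  \<open>(2 * N + 2) / (2 * N + 1)\<close>, which is the exponent claimed.\<close>

lemma secular_rate:
  fixes c K :: real
  assumes N: "N \<ge> 1" and c: "c > 0" and K: "K \<ge> 0"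
  shows "\<exists>C. \<forall>e t \<psi> \<Delta>. 0 \<le> e \<longrightarrow> e \<le> 1 \<longrightarrow> \<bar>t\<bar> \<le> 1 \<longrightarrow> c * \<bar>t\<bar> ^ N \<le> \<bar>\<psi>\<bar> \<longrightarrow>
           t\<^sup>2 * \<bar>\<psi>\<bar> \<le> K * e * t\<^sup>2 + K * e\<^sup>2 \<longrightarrow>
           \<bar>\<Delta>\<bar> \<le> K * \<bar>t\<bar> ^ Suc N + K * e\<^sup>2 + K * \<bar>t\<bar> * e \<longrightarrow>
           \<bar>\<Delta>\<bar> \<le> C * e powr (1 + 1 / (2 * N + 1))"
proof -
  \<comment> \<open>The two summands with \<open>2 * K / c\<close> come from the two regimes
    compared below; the 1 makes \<open>L \<le> L ^ (2 * N + 1)\<close>.\<close>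
  define L where "L = (2 * K / c)\<^sup>2 + 2 * K / c + 1"
  have L1: "L \<ge> 1" using K c by (simp add: L_def)
  have "\<bar>\<Delta>\<bar> \<le> (K * L ^ Suc N + K + K * L) * e powr (1 + 1 / (2 * N + 1))"
    if e: "0 \<le> e" "e \<le> 1" and t: "\<bar>t\<bar> \<le> 1" and psi: "c * \<bar>t\<bar> ^ N \<le> \<bar>\<psi>\<bar>"
      and bal: "t\<^sup>2 * \<bar>\<psi>\<bar> \<le> K * e * t\<^sup>2 + K * e\<^sup>2"
      and Delta: "\<bar>\<Delta>\<bar> \<le> K * \<bar>t\<bar> ^ Suc N + K * e\<^sup>2 + K * \<bar>t\<bar> * e" for e t \<psi> \<Delta> :: real
  proof -
    have "c * \<bar>t\<bar> ^ (N + 2) = t\<^sup>2 * (c * \<bar>t\<bar> ^ N)"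
      by (simp add: power_add power2_eq_square)
    also have "\<dots> \<le> t\<^sup>2 * \<bar>\<psi>\<bar>" using psi by (intro mult_left_mono) auto
    finally have main: "c * \<bar>t\<bar> ^ (N + 2) \<le> K * e * t\<^sup>2 + K * e\<^sup>2" using bal by simp
    \<comment> \<open>Whichever of e and \<open>t\<^sup>2\<close> is larger decides which term of
      the balance dominates. For \<open>e \<le> t\<^sup>2\<close> the N-th power of t is of order e;
      otherwise the power N + 2 is of order \<open>e\<^sup>2\<close>. As t is at most 1 and N at
      least 1, both give the exponent \<open>2 * N + 1\<close>.\<close>
    have "\<bar>t\<bar> ^ (2 * N + 1) \<le> L * e\<^sup>2"
    proof (cases "e \<le> t\<^sup>2")
      case True
      show ?thesis
      proof (cases "t = 0")
        case False
        have "K * e * e \<le> K * e * t\<^sup>2"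
          using True K e by (intro mult_left_mono) auto
        with main have "t\<^sup>2 * (c * \<bar>t\<bar> ^ N) \<le> t\<^sup>2 * (2 * K * e)"
          by (simp add: power_add power2_eq_square algebra_simps)
        then have "c * \<bar>t\<bar> ^ N \<le> 2 * K * e" using False by simp
        then have "\<bar>t\<bar> ^ N \<le> 2 * K / c * e" using c by (simp add: field_simps)
        then have "(\<bar>t\<bar> ^ N)\<^sup>2 \<le> (2 * K / c * e)\<^sup>2" by (intro power_mono) auto
        moreover have "\<bar>t\<bar> ^ (2 * N + 1) \<le> (\<bar>t\<bar> ^ N)\<^sup>2"
          unfolding power_mult[symmetric] using t by (intro power_decreasing) auto
        moreover have "(2 * K / c * e)\<^sup>2 \<le> L * e\<^sup>2"
          unfolding power_mult_distrib[of _ e] L_def using K c by (intro mult_right_mono) auto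
        ultimately show ?thesis by linarith
      qed (use L1 in auto)
    next
      case False
      then have "K * e * t\<^sup>2 \<le> K * e * e"
        using K e by (intro mult_left_mono) auto
      with main have "c * \<bar>t\<bar> ^ (N + 2) \<le> 2 * K * e\<^sup>2"
        by (simp add: power2_eq_square algebra_simps)
      then have "\<bar>t\<bar> ^ (N + 2) \<le> 2 * K / c * e\<^sup>2" using c by (simp add: field_simps)
      moreover have "2 * K / c * e\<^sup>2 \<le> L * e\<^sup>2"
        unfolding L_def using K c by (intro mult_right_mono) auto
      moreover have "\<bar>t\<bar> ^ (2 * N + 1) \<le> \<bar>t\<bar> ^ (N + 2)"
        using t N by (intro power_decreasing) auto
      ultimately show ?thesis by linarith
    qed
    \<comment> \<open>The size that the previous bound allows for t. Below, e = 0 is treated apart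
      because \<open>0 powr y\<close> is 0.\<close>
    define \<tau> where "\<tau> = e powr (2 / (2 * N + 1))"
    define R where "R = e powr (1 + 1 / (2 * N + 1))"
    have \<tau>: "\<tau> \<ge> 0" by (simp add: \<tau>_def)
    have \<tau>pow: "\<tau> ^ (2 * N + 1) = e\<^sup>2"
    proof (cases "e = 0")
      case False
      have "\<tau> ^ (2 * N + 1) = \<tau> powr real (2 * N + 1)"
        using False e by (subst powr_realpow) (auto simp: \<tau>_def)
      moreover have "2 / real (2 * N + 1) * real (2 * N + 1) = 2"
        by (subst nonzero_eq_divide_eq[symmetric]) simp_all
      then have "\<tau> powr real (2 * N + 1) = e powr 2"
        unfolding \<tau>_def powr_powr by (simp only: of_nat_add of_nat_mult of_nat_numeral of_nat_1)
      ultimately show ?thesis using False e by (simp add: powr_numeral)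
    qed (simp add: \<tau>_def)
    have "L * e\<^sup>2 \<le> L ^ (2 * N + 1) * e\<^sup>2"
      using L1 by (intro mult_right_mono self_le_power) auto
    then have "\<bar>t\<bar> ^ (2 * N + 1) \<le> (L * \<tau>) ^ (2 * N + 1)"
      using \<open>\<bar>t\<bar> ^ (2 * N + 1) \<le> L * e\<^sup>2\<close> unfolding power_mult_distrib \<tau>pow by linarith
    then have t\<tau>: "\<bar>t\<bar> \<le> L * \<tau>"
      using mult_nonneg_nonneg[of L \<tau>] L1 \<tau>
      by (simp only: Suc_eq_plus1[symmetric] power_le_imp_le_base[of "\<bar>t\<bar>" "2 * N" "L * \<tau>"])
    have \<tau>N: "\<tau> ^ Suc N = R"
    proof (cases "e = 0")
      case False
      have "\<tau> ^ Suc N = \<tau> powr real (Suc N)"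
        using False e by (subst powr_realpow) (auto simp: \<tau>_def)
      also have "\<dots> = R" unfolding \<tau>_def R_def powr_powr by (simp add: field_simps)
      finally show ?thesis .
    qed (simp add: \<tau>_def R_def)
    have \<tau>e: "\<tau> * e \<le> R"
    proof (cases "e = 0")
      case False
      then have "\<tau> * e = e powr (1 + 2 / (2 * N + 1))"
        using e by (simp add: \<tau>_def powr_add)
      also have "\<dots> \<le> R" unfolding R_def using e
        by (intro powr_mono') (auto intro: divide_right_mono)
      finally show ?thesis .
    qed (simp add: \<tau>_def R_def)
    have ee: "e\<^sup>2 \<le> R"
    proof (cases "e = 0")
      case False
      then have "e\<^sup>2 = e powr 2" using e by (simp add: powr_numeral)
      also have "\<dots> \<le> R" unfolding R_def using e
        by (intro powr_mono') (auto simp: field_simps)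
      finally show ?thesis .
    qed (simp add: R_def)
    have "K * \<bar>t\<bar> ^ Suc N \<le> K * (L * \<tau>) ^ Suc N"
      using t\<tau> K by (intro mult_left_mono power_mono) auto
    also have "\<dots> = K * L ^ Suc N * R"
      unfolding power_mult_distrib \<tau>N by simp
    finally have a1: "K * \<bar>t\<bar> ^ Suc N \<le> K * L ^ Suc N * R" .
    have a2: "K * e\<^sup>2 \<le> K * R" using ee K by (intro mult_left_mono) auto
    have "K * \<bar>t\<bar> * e \<le> K * (L * \<tau>) * e"
      using t\<tau> K e by (intro mult_left_mono mult_right_mono) auto
    also have "\<dots> = (K * L) * (\<tau> * e)" by simp
    also have "\<dots> \<le> (K * L) * R" using \<tau>e K L1 by (intro mult_left_mono) auto
    finally have a3: "K * \<bar>t\<bar> * e \<le> (K * L) * R" .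
    from Delta a1 a2 a3 have "\<bar>\<Delta>\<bar> \<le> K * L ^ Suc N * R + K * R + K * L * R" by linarith
    then show ?thesis by (simp only: R_def[symmetric] distrib_right)
  qed
  then show ?thesis by blast
qed

text \<open>Half of the gain \<open>\<kappa>\<close> pays for the constant, since
  \<open>\<bar>C\<bar> * e powr (\<kappa> / 2)\<close> falls below 1 for small e; the other half
  remains above \<open>\<eta>\<close>.\<close>

lemma eventually_absorb_powr_constant:
  fixes F :: "'a::metric_space \<Rightarrow> real"
  assumes ev: "\<forall>\<^sub>F x in nhds z. \<forall>e. 0 \<le> e \<longrightarrow> e \<le> 1 \<longrightarrow> Q x e \<longrightarrow> F x \<le> C * e powr (1 + \<kappa>)"
    and \<kappa>: "\<kappa> > 0"
  shows "\<forall>\<^sub>F \<eta> in at_right 0. \<forall>x e. dist x z < \<eta> \<longrightarrow> 0 \<le> e \<longrightarrow> e < \<eta> \<longrightarrow> Q x e \<longrightarrow>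
           F x \<le> e powr (1 + \<eta>)"
proof -
  obtain r where r: "r > 0"
    "\<And>x e. dist x z < r \<Longrightarrow> 0 \<le> e \<Longrightarrow> e \<le> 1 \<Longrightarrow> Q x e \<Longrightarrow> F x \<le> C * e powr (1 + \<kappa>)"
    using ev unfolding eventually_nhds_metric by blast
  have "((\<lambda>\<eta>. \<bar>C\<bar> * \<eta> powr (\<kappa> / 2)) \<longlongrightarrow> \<bar>C\<bar> * 0) (at_right 0)"
    using \<kappa> by (intro tendsto_intros tendsto_zero_powrI[where b = "\<kappa> / 2"])
      (auto simp: eventually_at_right_less intro!: tendsto_ident_at eventually_mono[OF eventually_at_right_less])
  then have "\<forall>\<^sub>F \<eta> in at_right 0. \<bar>C\<bar> * \<eta> powr (\<kappa> / 2) < 1"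
    by (rule order_tendstoD) simp
  moreover have "\<forall>\<^sub>F \<eta> in at_right 0. 0 < \<eta> \<and> \<eta> < min r (min 1 (\<kappa> / 2))"
    unfolding eventually_at_right_field using r \<kappa>
    by (intro exI[of _ "min r (min 1 (\<kappa> / 2))"]) auto
  ultimately show ?thesis
  proof (eventually_elim, intro allI impI)
    fix \<eta> x e
    assume C: "\<bar>C\<bar> * \<eta> powr (\<kappa> / 2) < 1" and "0 < \<eta> \<and> \<eta> < min r (min 1 (\<kappa> / 2))"
      and x: "dist x z < \<eta>" and e: "0 \<le> e" "e < \<eta>" and Q: "Q x e"
    then have \<eta>: "\<eta> < r" "\<eta> < 1" "\<eta> * 2 < \<kappa>" "0 < \<eta>" by auto
    have "F x \<le> C * e powr (1 + \<kappa>)" using r(2)[of x e] x e Q \<eta> by auto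
    also have "\<dots> \<le> \<bar>C\<bar> * e powr (1 + \<kappa>)" by (intro mult_right_mono) auto
    also have "\<dots> = (\<bar>C\<bar> * e powr (\<kappa> / 2)) * e powr (1 + \<kappa> / 2)"
      by (simp add: powr_add[symmetric] add.commute)
    also have "\<dots> \<le> 1 * e powr (1 + \<kappa> / 2)"
    proof (intro mult_right_mono)
      have "\<bar>C\<bar> * e powr (\<kappa> / 2) \<le> \<bar>C\<bar> * \<eta> powr (\<kappa> / 2)"
        using e \<kappa> by (intro mult_left_mono powr_mono2) auto
      then show "\<bar>C\<bar> * e powr (\<kappa> / 2) \<le> 1" using C by simp
    qed auto
    also have "\<dots> \<le> e powr (1 + \<eta>)"
      using \<eta> e by (simp, intro powr_mono') auto
    finally show "F x \<le> e powr (1 + \<eta>)" .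
  qed
qed

section \<open>The secular equation\<close>

text \<open>For frozen s the gradient vanishes at the coordinates
  \<open>- p b / (\<mu> b - s)\<close>. This is the value there of the quadratic with eigenvalues
  \<open>\<mu> b - s\<close>, less \<open>c\<^sup>2 / (2 * s)\<close>.\<close>

definition secular_value :: "'b set \<Rightarrow> ('b \<Rightarrow> real) \<Rightarrow> ('b \<Rightarrow> real) \<Rightarrow> real \<Rightarrow> real \<Rightarrow> real" where
  "secular_value F \<mu> p c s = - (\<Sum>b\<in>F. (p b)\<^sup>2 / (\<mu> b - s)) / 2 - c\<^sup>2 / (2 * s)"

text \<open>The squared norm of that frozen stationary point minus the squared norm
  \<open>(c / s)\<^sup>2\<close> that the choice of s presupposes; a zero of the gap is a solution
  of the secular equation.\<close>

definition secular_gap :: "'b set \<Rightarrow> ('b \<Rightarrow> real) \<Rightarrow> ('b \<Rightarrow> real) \<Rightarrow> real \<Rightarrow> real \<Rightarrow> real" where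
  "secular_gap F \<mu> p c s = (\<Sum>b\<in>F. (p b)\<^sup>2 / (\<mu> b - s)\<^sup>2) - c\<^sup>2 / s\<^sup>2"

text \<open>On F the relation \<open>w b = (\<mu> b - s) * X b + p b\<close> is solved for the
  coordinate and the square is completed. Off F it reads \<open>w b = - (s - s0) * X b\<close>,
  which loses the coordinate as s approaches s0; these coordinates enter all three identities
  through the sum of their squares.\<close>

lemma secular_identities:
  fixes X \<mu> p :: "'b \<Rightarrow> real" and c r s0 :: real
  assumes B: "finite B" "F \<subseteq> B" and r: "r > 0" "r\<^sup>2 = (\<Sum>b\<in>B. (X b)\<^sup>2)" and "c > 0"
    and F: "\<And>b. b \<in> F \<Longrightarrow> \<mu> b \<noteq> c / r" and E: "\<And>b. b \<in> B - F \<Longrightarrow> \<mu> b = s0 \<and> p b = 0"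
  defines "s \<equiv> c / r" and "w \<equiv> \<lambda>b. (\<mu> b - c / r) * X b + p b"
  shows "(\<Sum>b\<in>B. \<mu> b * (X b)\<^sup>2 / 2 + p b * X b) - c * r =
           secular_value F \<mu> p c s + (\<Sum>b\<in>F. (w b)\<^sup>2 / (\<mu> b - s)) / 2
           - (s - s0) / 2 * (\<Sum>b\<in>B - F. (X b)\<^sup>2)"
    and "secular_gap F \<mu> p c s + (\<Sum>b\<in>B - F. (X b)\<^sup>2) =
           (\<Sum>b\<in>F. (2 * p b * w b - (w b)\<^sup>2) / (\<mu> b - s)\<^sup>2)"
    and "(s - s0)\<^sup>2 * (\<Sum>b\<in>B - F. (X b)\<^sup>2) = (\<Sum>b\<in>B - F. (w b)\<^sup>2)"
proof -
  have split: "sum g B = sum g F + sum g (B - F)" for g :: "'b \<Rightarrow> real"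
    using B by (metis add.commute sum.subset_diff)
  have s: "s > 0" using r \<open>c > 0\<close> by (simp add: s_def)
  have w: "w b = (\<mu> b - s) * X b + p b" for b by (simp add: w_def s_def)
  have ne: "\<mu> b - s \<noteq> 0" if "b \<in> F" for b using F[OF that] by (simp add: s_def)
  have wE: "w b = - (s - s0) * X b" if "b \<in> B - F" for b
    using E[OF that] by (simp add: w)
  \<comment> \<open>With \<open>s = c / r\<close> both summands equal half of \<open>c * r\<close>.
    The first is quadratic in X and shifts every eigenvalue by s, which makes the nonsmooth norm
    disappear.\<close>
  have cr: "c * r = s / 2 * (\<Sum>b\<in>B. (X b)\<^sup>2) + c\<^sup>2 / (2 * s)"
    using r(1) \<open>c > 0\<close> unfolding r(2)[symmetric] s_def by (simp add: field_simps power2_eq_square)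
  have "(\<Sum>b\<in>B. \<mu> b * (X b)\<^sup>2 / 2 + p b * X b) - c * r
      = (\<Sum>b\<in>B. (\<mu> b - s) * (X b)\<^sup>2 / 2 + p b * X b) - c\<^sup>2 / (2 * s)"
    unfolding cr sum_distrib_left
    by (simp add: sum.distrib left_diff_distrib diff_divide_distrib sum_subtractf)
  also have "(\<Sum>b\<in>B. (\<mu> b - s) * (X b)\<^sup>2 / 2 + p b * X b) =
      (\<Sum>b\<in>F. ((w b)\<^sup>2 - (p b)\<^sup>2) / (\<mu> b - s) / 2) + (\<Sum>b\<in>B - F. - (s - s0) / 2 * (X b)\<^sup>2)"
    unfolding split
  proof (intro arg_cong2[of _ _ _ _ "(+)"] sum.cong refl)
    fix b assume "b \<in> F"
    from ne[OF this] show "(\<mu> b - s) * (X b)\<^sup>2 / 2 + p b * X b = ((w b)\<^sup>2 - (p b)\<^sup>2) / (\<mu> b - s) / 2"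
      unfolding w by (simp add: field_simps power2_eq_square)
  next
    fix b assume "b \<in> B - F"
    from E[OF this] show "(\<mu> b - s) * (X b)\<^sup>2 / 2 + p b * X b = - (s - s0) / 2 * (X b)\<^sup>2"
      by (simp add: field_simps)
  qed
  finally show "(\<Sum>b\<in>B. \<mu> b * (X b)\<^sup>2 / 2 + p b * X b) - c * r =
      secular_value F \<mu> p c s + (\<Sum>b\<in>F. (w b)\<^sup>2 / (\<mu> b - s)) / 2
        - (s - s0) / 2 * (\<Sum>b\<in>B - F. (X b)\<^sup>2)"
    unfolding secular_value_def sum_distrib_left[symmetric] sum_divide_distrib[symmetric]
      diff_divide_distrib sum_subtractf by (simp add: field_simps)
  have "c\<^sup>2 / s\<^sup>2 = (\<Sum>b\<in>F. (X b)\<^sup>2) + (\<Sum>b\<in>B - F. (X b)\<^sup>2)"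
    using r \<open>c > 0\<close> unfolding split[symmetric] r(2)[symmetric] s_def by (simp add: field_simps)
  moreover have "(p b)\<^sup>2 / (\<mu> b - s)\<^sup>2 - (X b)\<^sup>2 = (2 * p b * w b - (w b)\<^sup>2) / (\<mu> b - s)\<^sup>2"
    if "b \<in> F" for b
  proof -
    have "X b = (w b - p b) / (\<mu> b - s)" using ne[OF that] by (simp add: w field_simps)
    then show ?thesis
      by (simp add: power_divide diff_divide_distrib[symmetric]) (simp add: power2_eq_square algebra_simps)
  qed
  ultimately show "secular_gap F \<mu> p c s + (\<Sum>b\<in>B - F. (X b)\<^sup>2) =
      (\<Sum>b\<in>F. (2 * p b * w b - (w b)\<^sup>2) / (\<mu> b - s)\<^sup>2)"
    unfolding secular_gap_def by (simp add: sum_subtractf[symmetric])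
  show "(s - s0)\<^sup>2 * (\<Sum>b\<in>B - F. (X b)\<^sup>2) = (\<Sum>b\<in>B - F. (w b)\<^sup>2)"
    unfolding sum_distrib_left by (intro sum.cong refl) (simp only: wE power_mult_distrib power2_minus)
qed

text \<open>The link between value and secular equation: the order to which the gap vanishes governs
  how far the value can move as s varies.\<close>

lemma secular_value_derivative:
  assumes "s \<noteq> 0" "\<And>b. b \<in> F \<Longrightarrow> \<mu> b \<noteq> s"
  shows "(secular_value F \<mu> p c has_real_derivative - secular_gap F \<mu> p c s / 2) (at s)"
proof -
  have "((\<lambda>s. - (\<Sum>b\<in>F. (p b)\<^sup>2 / (\<mu> b - s)) / 2 - c\<^sup>2 / (2 * s)) has_real_derivative
     - (\<Sum>b\<in>F. (p b)\<^sup>2 / (\<mu> b - s)\<^sup>2) / 2 - (- (c\<^sup>2 / (2 * s\<^sup>2)))) (at s)"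
    using assms
    by (intro derivative_intros DERIV_sum)
      (auto intro!: derivative_eq_intros simp: field_simps power2_eq_square)
  then show ?thesis
    unfolding secular_value_def[abs_def] secular_gap_def by (simp add: field_simps)
qed

lemma secular_gap_differentiable:
  assumes "finite F" "s \<noteq> 0" "\<And>b. b \<in> F \<Longrightarrow> \<mu> b \<noteq> s"
  shows "\<exists>D. (secular_gap F \<mu> p c has_real_derivative D) (at s)"
proof -
  have "secular_gap F \<mu> p c differentiable at s"
    unfolding secular_gap_def[abs_def] using assms
    by (intro derivative_intros differentiable_sum) auto
  then show ?thesis by (simp add: real_differentiable_def)
qed

text \<open>The gap vanishes to finite order: its numerator is a polynomial whose value at $0$ is
  $-c^2 \prod_b \mu_b^2 \neq 0$.\<close>

lemma secular_gap_order:
  assumes F: "finite F" and \<mu>: "\<And>b. b \<in> F \<Longrightarrow> \<mu> b > 0" and "c > 0"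
    and s0: "s0 \<noteq> 0" "\<And>b. b \<in> F \<Longrightarrow> \<mu> b \<noteq> s0"
  shows "\<exists>N\<ge>1. \<exists>C. \<exists>\<kappa>>0. \<forall>\<^sub>F s in nhds s0.
           \<bar>secular_gap F \<mu> p c s - secular_gap F \<mu> p c s0\<bar> \<le> C * \<bar>s - s0\<bar> ^ N \<and>
           \<kappa> * \<bar>s - s0\<bar> ^ N \<le> \<bar>secular_gap F \<mu> p c s\<bar>"
proof -
  define lin where "lin b = [:\<mu> b, -1:]" for b
  define q where "q = (\<Sum>b\<in>F. smult ((p b)\<^sup>2) ([:0, 1:]\<^sup>2 * (\<Prod>a\<in>F - {b}. (lin a)\<^sup>2)))
    - smult (c\<^sup>2) (\<Prod>a\<in>F. (lin a)\<^sup>2)"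
  define d where "d s = s\<^sup>2 * (\<Prod>a\<in>F. (\<mu> a - s)\<^sup>2)" for s
  have pq: "poly q s = (\<Sum>b\<in>F. (p b)\<^sup>2 * (s\<^sup>2 * (\<Prod>a\<in>F - {b}. (\<mu> a - s)\<^sup>2)))
      - c\<^sup>2 * (\<Prod>a\<in>F. (\<mu> a - s)\<^sup>2)" for s
  proof -
    have "poly (lin a) s = \<mu> a - s" for a by (simp add: lin_def)
    then show ?thesis by (simp add: q_def poly_sum poly_prod poly_power)
  qed
  have "poly q 0 \<noteq> 0"
    unfolding pq using F \<open>c > 0\<close> \<mu> by (simp add: prod_zero_iff) force
  then have "q \<noteq> 0" by auto
  moreover obtain D where "(secular_gap F \<mu> p c has_real_derivative D) (at s0)"
    using secular_gap_differentiable[of F s0 \<mu> p c] F s0 by blast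
  moreover have "isCont d s0" unfolding d_def[abs_def] by (intro continuous_intros)
  moreover have "d s0 \<noteq> 0" using s0 F by (auto simp: d_def)
  moreover have "\<forall>\<^sub>F s in nhds s0. secular_gap F \<mu> p c s * d s = poly q s"
  proof -
    have "\<forall>\<^sub>F s in nhds s0. s \<noteq> 0"
      using s0(1) by (rule t1_space_nhds)
    moreover have "\<forall>\<^sub>F s in nhds s0. \<forall>b\<in>F. \<mu> b \<noteq> s"
      using F s0(2)
      by (intro eventually_ball_finite ballI)
        (auto simp: eq_commute[of "\<mu> _"] intro!: t1_space_nhds)
    ultimately show ?thesis
    proof eventually_elim
      case (elim s)
      have "(p b)\<^sup>2 / (\<mu> b - s)\<^sup>2 * d s = (p b)\<^sup>2 * (s\<^sup>2 * (\<Prod>a\<in>F - {b}. (\<mu> a - s)\<^sup>2))" if "b \<in> F" for b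
        using elim(2) that F unfolding d_def by (simp add: prod.remove[OF F that])
      moreover have "c\<^sup>2 / s\<^sup>2 * d s = c\<^sup>2 * (\<Prod>a\<in>F. (\<mu> a - s)\<^sup>2)"
        using elim(1) by (simp add: d_def)
      ultimately show ?case
        unfolding pq secular_gap_def left_diff_distrib sum_distrib_right by simp
    qed
  qed
  ultimately show ?thesis by (rule rational_order_bounds)
qed

text \<open>The mean value theorem for D plus a linear term. The slope is taken at the moving end s
  instead of at s0, because the elimination of the degenerate coordinates later produces exactly
  \<open>(s - s0) / 2 * \<psi> s\<close>.\<close>

lemma secular_value_expansion:
  fixes D \<psi> :: "real \<Rightarrow> real"
  assumes der: "\<And>u. \<bar>u - s0\<bar> < \<rho> \<Longrightarrow> (D has_real_derivative - \<psi> u / 2) (at u)"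
    and osc: "\<And>u. \<bar>u - s0\<bar> < \<rho> \<Longrightarrow> \<bar>\<psi> u - \<psi> s0\<bar> \<le> C * \<bar>u - s0\<bar> ^ N"
    and s: "\<bar>s - s0\<bar> < \<rho>"
  shows "\<bar>D s - D s0 + (s - s0) / 2 * \<psi> s\<bar> \<le> \<bar>C\<bar> * \<bar>s - s0\<bar> ^ Suc N"
proof -
  define r where "r = \<bar>s - s0\<bar>"
  define G where "G u = D u + u * \<psi> s / 2" for u
  have osc': "\<bar>\<psi> u - \<psi> s0\<bar> \<le> \<bar>C\<bar> * r ^ N" if "\<bar>u - s0\<bar> \<le> r" for u
  proof -
    have "C * \<bar>u - s0\<bar> ^ N \<le> \<bar>C\<bar> * \<bar>u - s0\<bar> ^ N" by (intro mult_right_mono) auto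
    also have "\<dots> \<le> \<bar>C\<bar> * r ^ N" using that by (intro mult_left_mono power_mono) auto
    finally show ?thesis using osc[of u] that s by (auto simp: r_def)
  qed
  have "norm (G s - G s0) \<le> (\<bar>C\<bar> * r ^ N) * norm (s - s0)"
  proof (rule field_differentiable_bound[of "cball s0 r" G "\<lambda>u. - \<psi> u / 2 + \<psi> s / 2"])
    fix u assume "u \<in> cball s0 r"
    then have u: "\<bar>u - s0\<bar> \<le> r" by (simp add: dist_real_def abs_minus_commute)
    have "(G has_real_derivative - \<psi> u / 2 + \<psi> s / 2) (at u)"
      unfolding G_def[abs_def] using der[of u] u s
      by (auto intro!: derivative_eq_intros simp: r_def)
    then show "(G has_real_derivative - \<psi> u / 2 + \<psi> s / 2) (at u within cball s0 r)"
      by (rule has_field_derivative_at_within)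
    have "\<bar>\<psi> s - \<psi> u\<bar> \<le> \<bar>\<psi> s - \<psi> s0\<bar> + \<bar>\<psi> u - \<psi> s0\<bar>" by linarith
    also have "\<dots> \<le> \<bar>C\<bar> * r ^ N + \<bar>C\<bar> * r ^ N"
      using osc'[OF u] osc'[of s] by (simp add: r_def)
    finally show "norm (- \<psi> u / 2 + \<psi> s / 2) \<le> \<bar>C\<bar> * r ^ N" by simp
  qed (auto simp: r_def dist_real_def abs_minus_commute)
  then show ?thesis by (simp add: G_def r_def algebra_simps diff_divide_distrib)
qed

text \<open>With $s = c / \|x\|$ the gradient $w$ of $f$ is affine in $x$ for fixed $s$, so $f(x)$ equals
  \<^term>\<open>secular_value\<close> at $s$ up to $O(\|w\|^2)$ and the contribution of the eigenvectors $b$ with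
  $\mu_b = c / \|z\|$. The Lojasiewicz inequality is thereby reduced to the order of vanishing of the
  one-variable rational function \<^term>\<open>secular_gap\<close> at $c / \|z\|$.\<close>

lemma secular_lojasiewicz:
  fixes B :: "'a::euclidean_space set" and \<mu> :: "'a \<Rightarrow> real" and p z :: 'a and c :: real
  assumes B: "pairwise orthogonal B" "\<And>b. b \<in> B \<Longrightarrow> norm b = 1" and \<mu>: "\<And>b. b \<in> B \<Longrightarrow> \<mu> b > 0"
    and c: "c > 0" and z: "z \<in> span B" "z \<noteq> 0"
  defines "f \<equiv> \<lambda>x. (\<Sum>b\<in>B. \<mu> b * (b \<bullet> x)\<^sup>2 / 2 + (b \<bullet> p) * (b \<bullet> x)) - c * norm x"
    and "w \<equiv> \<lambda>x b. (\<mu> b - c / norm x) * (b \<bullet> x) + b \<bullet> p"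
  shows "\<forall>\<^sub>F \<eta> in at_right 0. \<forall>x e. dist x z < \<eta> \<longrightarrow> 0 \<le> e \<longrightarrow> e < \<eta> \<longrightarrow>
           x \<in> span B \<and> (\<forall>b\<in>B. \<bar>w x b\<bar> \<le> e) \<longrightarrow> \<bar>f x - f z\<bar> \<le> e powr (1 + \<eta>)"
proof (cases "\<forall>b\<in>B. w z b = 0")
  case False
  then obtain b where b: "b \<in> B" "w z b \<noteq> 0" by blast
  \<comment> \<open>At a point that is not critical the claim is vacuous: near z some component of
    the gradient stays above a fixed positive bound, so no e below \<open>\<eta>\<close> is
    admissible.\<close>
  have "((\<lambda>x. \<bar>w x b\<bar>) \<longlongrightarrow> \<bar>w z b\<bar>) (nhds z)"
    unfolding w_def using z(2) by (intro tendsto_intros filterlim_ident) auto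
  then have "\<forall>\<^sub>F x in nhds z. \<bar>w z b\<bar> / 2 < \<bar>w x b\<bar>"
    by (rule order_tendstoD) (use b in simp)
  then obtain r where r: "r > 0" "\<And>x. dist x z < r \<Longrightarrow> \<bar>w z b\<bar> / 2 < \<bar>w x b\<bar>"
    unfolding eventually_nhds_metric by blast
  show ?thesis
    unfolding eventually_at_right_field
  proof (intro exI[of _ "min r (\<bar>w z b\<bar> / 2)"] conjI allI impI)
    fix \<eta> x e
    assume *: "0 < \<eta>" "\<eta> < min r (\<bar>w z b\<bar> / 2)" "dist x z < \<eta>" "e < \<eta>"
      "x \<in> span B \<and> (\<forall>b\<in>B. \<bar>w x b\<bar> \<le> e)"
    then have "\<bar>w x b\<bar> \<le> e" using b by blast
    moreover have "\<bar>w z b\<bar> / 2 < \<bar>w x b\<bar>" using * by (intro r) auto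
    ultimately show "\<bar>f x - f z\<bar> \<le> e powr (1 + \<eta>)" using * by linarith
  qed (use r b in auto)
next
  case crit: True
  define s0 where "s0 = c / norm z"
  \<comment> \<open>The coordinates that the gradient determines near z. For the others criticality
    of z gives \<open>P b = 0\<close>, so their terms can be left out of the secular
    functions.\<close>
  define F where "F = {b \<in> B. \<mu> b \<noteq> s0}"
  define P where "P b = b \<bullet> p" for b
  define D where "D = secular_value F \<mu> P c"
  define \<psi> where "\<psi> = secular_gap F \<mu> P c"
  have s0: "s0 > 0" using c z by (simp add: s0_def)
  have fin: "finite B" using orthonormal_coordinates(1)[OF B z(1)] .
  have nsq: "(norm x)\<^sup>2 = (\<Sum>b\<in>B. (b \<bullet> x)\<^sup>2)" if "x \<in> span B" for x
    using orthonormal_coordinates(3)[OF B that] .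
  have FB: "F \<subseteq> B" by (auto simp: F_def)
  with fin have finF: "finite F" by (rule rev_finite_subset)
  have E: "\<mu> b = s0 \<and> P b = 0" if "b \<in> B - F" for b
    using crit that by (auto simp: F_def w_def P_def s0_def)
  obtain N C \<kappa> where N: "N \<ge> 1" and \<kappa>: "\<kappa> > 0"
    and ord: "\<forall>\<^sub>F s in nhds s0. \<bar>\<psi> s - \<psi> s0\<bar> \<le> C * \<bar>s - s0\<bar> ^ N \<and> \<kappa> * \<bar>s - s0\<bar> ^ N \<le> \<bar>\<psi> s\<bar>"
    using secular_gap_order[of F \<mu> c s0 P] finF \<mu> c s0 unfolding \<psi>_def F_def by blast
  define m where "m b = \<bar>\<mu> b - s0\<bar> / 2" for b
  have m: "m b > 0" if "b \<in> F" for b using that by (simp add: m_def F_def)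
  have "\<forall>\<^sub>F s in nhds s0. m b < \<bar>\<mu> b - s\<bar>" if "b \<in> F" for b
    by (rule order_tendstoD(1)[of _ "\<bar>\<mu> b - s0\<bar>"])
      (use m[OF that] in \<open>auto intro!: tendsto_intros filterlim_ident simp: m_def\<close>)
  then have "\<forall>\<^sub>F s in nhds s0. \<forall>b\<in>F. m b < \<bar>\<mu> b - s\<bar>"
    using finF by (intro eventually_ball_finite) auto
  moreover have "\<forall>\<^sub>F s in nhds s0. 0 < s"
    using s0 by (intro order_tendstoD(1)[OF filterlim_ident])
  ultimately have "\<forall>\<^sub>F s in nhds s0. (\<forall>b\<in>F. m b < \<bar>\<mu> b - s\<bar>) \<and> 0 < s \<and>
     \<bar>\<psi> s - \<psi> s0\<bar> \<le> C * \<bar>s - s0\<bar> ^ N \<and> \<kappa> * \<bar>s - s0\<bar> ^ N \<le> \<bar>\<psi> s\<bar>"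
    using ord by eventually_elim blast
  then obtain \<rho>' where \<rho>': "\<rho>' > 0" and near': "\<And>s. \<bar>s - s0\<bar> < \<rho>' \<Longrightarrow> (\<forall>b\<in>F. m b < \<bar>\<mu> b - s\<bar>) \<and> 0 < s \<and>
     \<bar>\<psi> s - \<psi> s0\<bar> \<le> C * \<bar>s - s0\<bar> ^ N \<and> \<kappa> * \<bar>s - s0\<bar> ^ N \<le> \<bar>\<psi> s\<bar>"
    unfolding eventually_nhds_metric dist_real_def by blast
  \<comment> \<open>The cap 1 provides the bound \<open>\<bar>t\<bar> \<le> 1\<close> required by
    \<open>secular_rate\<close>.\<close>
  define \<rho> where "\<rho> = min \<rho>' 1"
  have \<rho>: "\<rho> > 0" "\<rho> \<le> 1" using \<rho>' by (auto simp: \<rho>_def)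
  have near: "(\<forall>b\<in>F. m b < \<bar>\<mu> b - s\<bar>) \<and> 0 < s \<and>
     \<bar>\<psi> s - \<psi> s0\<bar> \<le> C * \<bar>s - s0\<bar> ^ N \<and> \<kappa> * \<bar>s - s0\<bar> ^ N \<le> \<bar>\<psi> s\<bar>"
    if "\<bar>s - s0\<bar> < \<rho>" for s
    using near'[of s] that by (simp add: \<rho>_def)
  define K1 where "K1 = (\<Sum>b\<in>F. (2 * \<bar>P b\<bar> + 1) / (m b)\<^sup>2)"
  define K2 where "K2 = (\<Sum>b\<in>F. 1 / m b)"
  define K where "K = K1 + K2 + real (card (B - F)) + \<bar>C\<bar>"
  have K12: "K1 \<ge> 0" "K2 \<ge> 0" unfolding K1_def K2_def using m by (simp_all add: sum_nonneg less_imp_le)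
  then have K: "K \<ge> 0" by (simp add: K_def)
  obtain L where L: "\<And>e t \<psi> \<Delta>. 0 \<le> e \<Longrightarrow> e \<le> 1 \<Longrightarrow> \<bar>t\<bar> \<le> 1 \<Longrightarrow> \<kappa> * \<bar>t\<bar> ^ N \<le> \<bar>\<psi>\<bar> \<Longrightarrow>
           t\<^sup>2 * \<bar>\<psi>\<bar> \<le> K * e * t\<^sup>2 + K * e\<^sup>2 \<Longrightarrow>
           \<bar>\<Delta>\<bar> \<le> K * \<bar>t\<bar> ^ Suc N + K * e\<^sup>2 + K * \<bar>t\<bar> * e \<Longrightarrow>
           \<bar>\<Delta>\<bar> \<le> L * e powr (1 + 1 / (2 * N + 1))"
    using secular_rate[OF N \<kappa> K] by blast
  have fz: "f z = D s0"
  proof -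
    have "norm z > 0" using z by simp
    note id = secular_identities(1)[OF fin FB this nsq[OF z(1)] c, of \<mu> s0 P,
        folded s0_def]
    have "f z = D s0 + (\<Sum>b\<in>F. (w z b)\<^sup>2 / (\<mu> b - s0)) / 2 - (s0 - s0) / 2 * (\<Sum>b\<in>B - F. (b \<bullet> z)\<^sup>2)"
      using id[OF _ E] by (simp add: F_def f_def D_def w_def P_def s0_def[symmetric])
    moreover have "(\<Sum>b\<in>F. (w z b)\<^sup>2 / (\<mu> b - s0)) = 0"
      using crit by (intro sum.neutral) (auto simp: F_def)
    ultimately show ?thesis by simp
  qed
  have "((\<lambda>x. c / norm x) \<longlongrightarrow> s0) (nhds z)"
    unfolding s0_def using z(2) by (intro tendsto_intros filterlim_ident) auto
  then have "\<forall>\<^sub>F x in nhds z. dist (c / norm x) s0 < \<rho>"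
    using \<rho>(1) by (rule tendstoD)
  moreover have "\<forall>\<^sub>F x in nhds z. x \<noteq> 0"
    using z(2) by (rule t1_space_nhds)
  ultimately have "\<forall>\<^sub>F x in nhds z. \<forall>e. 0 \<le> e \<longrightarrow> e \<le> 1 \<longrightarrow> x \<in> span B \<and> (\<forall>b\<in>B. \<bar>w x b\<bar> \<le> e) \<longrightarrow>
      \<bar>f x - f z\<bar> \<le> L * e powr (1 + 1 / (2 * N + 1))"
  proof (eventually_elim, intro allI impI, elim conjE)
    fix x e
    assume xs: "dist (c / norm x) s0 < \<rho>" and x0: "x \<noteq> 0" and e: "0 \<le> e" "e \<le> 1" and xB: "x \<in> span B"
      and we: "\<forall>b\<in>B. \<bar>w x b\<bar> \<le> e"
    define s where "s = c / norm x"
    define t where "t = s - s0"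
    define q where "q = (\<Sum>b\<in>B - F. (b \<bullet> x)\<^sup>2)"
    define S1 where "S1 = (\<Sum>b\<in>F. (w x b)\<^sup>2 / (\<mu> b - s))"
    define S2 where "S2 = (\<Sum>b\<in>F. (2 * P b * w x b - (w x b)\<^sup>2) / (\<mu> b - s)\<^sup>2)"
    have t: "\<bar>s - s0\<bar> < \<rho>" using xs by (simp add: s_def dist_real_def)
    note nt = near[OF t]
    have "norm x > 0" using x0 by simp
    note id = secular_identities[OF fin _ this nsq[OF xB] c, of F \<mu> s0 P,
        folded s_def]
    have Fs: "\<mu> b \<noteq> s" if "b \<in> F" for b using nt m[OF that] that by force
    have i1: "f x = D s + S1 / 2 - t / 2 * q"
      using id(1)[OF FB Fs E] by (simp add: f_def D_def w_def s_def S1_def q_def t_def P_def)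
    have i2: "\<psi> s + q = S2"
      using id(2)[OF FB Fs E] by (simp add: \<psi>_def w_def s_def S2_def q_def P_def)
    have i3: "t\<^sup>2 * q = (\<Sum>b\<in>B - F. (w x b)\<^sup>2)"
      using id(3)[OF FB Fs E] by (simp add: w_def s_def q_def P_def t_def)
    have w2: "(w x b)\<^sup>2 \<le> e\<^sup>2" if "b \<in> B" for b
      using we that e by (metis power2_abs abs_ge_zero power_mono)
    have "norm S1 \<le> (\<Sum>b\<in>F. 1 / m b * e\<^sup>2)"
      unfolding S1_def
    proof (rule sum_norm_le)
      fix b assume b: "b \<in> F"
      have "\<bar>(w x b)\<^sup>2 / (\<mu> b - s)\<bar> = (w x b)\<^sup>2 / \<bar>\<mu> b - s\<bar>" by simp
      also have "\<dots> \<le> e\<^sup>2 / m b"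
        using w2[of b] b FB m[OF b] nt by (intro frac_le) (auto simp: less_imp_le)
      finally show "norm ((w x b)\<^sup>2 / (\<mu> b - s)) \<le> 1 / m b * e\<^sup>2" by simp
    qed
    then have S1: "\<bar>S1\<bar> \<le> K2 * e\<^sup>2" by (simp only: K2_def sum_distrib_right real_norm_def)
    have "norm S2 \<le> (\<Sum>b\<in>F. (2 * \<bar>P b\<bar> + 1) / (m b)\<^sup>2 * e)"
      unfolding S2_def
    proof (rule sum_norm_le)
      fix b assume b: "b \<in> F"
      have web: "\<bar>w x b\<bar> \<le> e" using we b FB by auto
      have "\<bar>2 * P b * w x b - (w x b)\<^sup>2\<bar> \<le> \<bar>2 * P b * w x b\<bar> + (w x b)\<^sup>2"
        using abs_triangle_ineq4[of "2 * P b * w x b" "(w x b)\<^sup>2"] by simp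
      also have "\<dots> = 2 * \<bar>P b\<bar> * \<bar>w x b\<bar> + \<bar>w x b\<bar> * \<bar>w x b\<bar>"
        by (simp add: abs_mult power2_eq_square)
      also have "\<dots> \<le> 2 * \<bar>P b\<bar> * e + 1 * e"
        using web e by (intro add_mono mult_left_mono mult_mono) auto
      finally have num: "\<bar>2 * P b * w x b - (w x b)\<^sup>2\<bar> \<le> (2 * \<bar>P b\<bar> + 1) * e" by (simp add: distrib_right)
      have "(m b)\<^sup>2 \<le> \<bar>\<mu> b - s\<bar>\<^sup>2" using nt m[OF b] b by (intro power_mono) (auto simp: less_imp_le)
      then have "\<bar>(2 * P b * w x b - (w x b)\<^sup>2) / (\<mu> b - s)\<^sup>2\<bar> \<le> (2 * \<bar>P b\<bar> + 1) * e / (m b)\<^sup>2"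
        unfolding abs_divide using num m[OF b] e by (intro frac_le) auto
      then show "norm ((2 * P b * w x b - (w x b)\<^sup>2) / (\<mu> b - s)\<^sup>2) \<le> (2 * \<bar>P b\<bar> + 1) / (m b)\<^sup>2 * e"
        by simp
    qed
    then have S2: "\<bar>S2\<bar> \<le> K1 * e" by (simp only: K1_def sum_distrib_right real_norm_def)
    have S3: "t\<^sup>2 * q \<le> real (card (B - F)) * e\<^sup>2"
      unfolding i3 using sum_bounded_above[of "B - F" "\<lambda>b. (w x b)\<^sup>2" "e\<^sup>2"] w2 by simp
    have q0: "q \<ge> 0" by (simp add: q_def sum_nonneg)
    have dM: "\<bar>D s - D s0 + (s - s0) / 2 * \<psi> s\<bar> \<le> \<bar>C\<bar> * \<bar>s - s0\<bar> ^ Suc N"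
    proof (rule secular_value_expansion[OF _ _ t])
      fix u assume u: "\<bar>u - s0\<bar> < \<rho>"
      show "(D has_real_derivative - \<psi> u / 2) (at u)"
        unfolding D_def \<psi>_def using near[OF u] m
        by (intro secular_value_derivative) force+
      show "\<bar>\<psi> u - \<psi> s0\<bar> \<le> C * \<bar>u - s0\<bar> ^ N" using near[OF u] by simp
    qed
    \<comment> \<open>The unknown mass q is replaced by \<open>S2 - \<psi> s\<close>. What remains
      is the expansion error of D and terms that are small with the gradient.\<close>
    have eq: "f x - f z = (D s - D s0 + t / 2 * \<psi> s) + S1 / 2 - t / 2 * S2"
      unfolding i1 fz i2[symmetric] by (simp add: field_simps)
    have "\<bar>f x - f z\<bar> \<le> \<bar>D s - D s0 + t / 2 * \<psi> s\<bar> + \<bar>S1 / 2\<bar> + \<bar>t / 2 * S2\<bar>"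
      unfolding eq by linarith
    also have "\<dots> \<le> \<bar>C\<bar> * \<bar>t\<bar> ^ Suc N + K2 * e\<^sup>2 + \<bar>t\<bar> * (K1 * e)"
    proof (intro add_mono)
      show "\<bar>D s - D s0 + t / 2 * \<psi> s\<bar> \<le> \<bar>C\<bar> * \<bar>t\<bar> ^ Suc N" using dM by (simp add: t_def)
      show "\<bar>S1 / 2\<bar> \<le> K2 * e\<^sup>2" using S1 by simp
      have "\<bar>t / 2 * S2\<bar> \<le> \<bar>t\<bar> * \<bar>S2\<bar>" unfolding abs_mult by (intro mult_right_mono) auto
      also have "\<dots> \<le> \<bar>t\<bar> * (K1 * e)" using S2 by (intro mult_left_mono) auto
      finally show "\<bar>t / 2 * S2\<bar> \<le> \<bar>t\<bar> * (K1 * e)" .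
    qed
    also have "\<dots> \<le> K * \<bar>t\<bar> ^ Suc N + K * e\<^sup>2 + K * \<bar>t\<bar> * e"
    proof (intro add_mono mult_right_mono)
      have "\<bar>t\<bar> * (K1 * e) = K1 * (\<bar>t\<bar> * e)" by simp
      also have "\<dots> \<le> K * (\<bar>t\<bar> * e)"
        using K12 e by (intro mult_right_mono) (auto simp: K_def)
      finally show "\<bar>t\<bar> * (K1 * e) \<le> K * \<bar>t\<bar> * e" by simp
    qed (use K12 in \<open>auto simp: K_def\<close>)
    finally have "\<bar>f x - f z\<bar> \<le> K * \<bar>t\<bar> ^ Suc N + K * e\<^sup>2 + K * \<bar>t\<bar> * e" .
    \<comment> \<open>There is no direct bound on q, but \<open>t\<^sup>2 * q\<close> is the squared
      gradient in the degenerate directions. Hence the norm identity is used after multiplication by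
      \<open>t\<^sup>2\<close>.\<close>
    moreover have "t\<^sup>2 * \<bar>\<psi> s\<bar> \<le> K * e * t\<^sup>2 + K * e\<^sup>2"
    proof -
      have "\<bar>\<psi> s\<bar> \<le> K1 * e + q" using i2 S2 q0 by linarith
      then have "t\<^sup>2 * \<bar>\<psi> s\<bar> \<le> t\<^sup>2 * (K1 * e + q)" by (intro mult_left_mono) auto
      also have "\<dots> \<le> K1 * (e * t\<^sup>2) + real (card (B - F)) * e\<^sup>2" using S3 by (simp add: algebra_simps)
      also have "\<dots> \<le> K * (e * t\<^sup>2) + K * e\<^sup>2"
        using K12 e by (intro add_mono mult_right_mono) (auto simp: K_def)
      finally show ?thesis by simp
    qed
    moreover have "\<kappa> * \<bar>t\<bar> ^ N \<le> \<bar>\<psi> s\<bar>" "\<bar>t\<bar> \<le> 1"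
      using nt t \<rho> by (auto simp: t_def)
    ultimately show "\<bar>f x - f z\<bar> \<le> L * e powr (1 + 1 / (2 * N + 1))"
      using e by (intro L)
  qed
  then show ?thesis
    by (rule eventually_absorb_powr_constant) (simp add: add_pos_nonneg)
qed

section \<open>The Lojasiewicz inequality on the faces\<close>

lemma orthonormal_inner:
  fixes x u :: "'a::euclidean_space"
  assumes "pairwise orthogonal B" "\<And>b. b \<in> B \<Longrightarrow> norm b = 1" "x \<in> span B"
  shows "(\<Sum>b\<in>B. (b \<bullet> x) * (b \<bullet> u)) = x \<bullet> u"
proof -
  have "x \<bullet> u = (\<Sum>b\<in>B. (b \<bullet> x) *\<^sub>R b) \<bullet> u"
    by (rule arg_cong[OF orthonormal_coordinates(2)[OF assms], of "\<lambda>y. y \<bullet> u"])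
  then show ?thesis by (simp add: inner_sum_left)
qed

lemma transpose_inner: "(transpose A *v y) \<bullet> x = y \<bullet> (A *v x)"
  for A :: "real ^ 'n ^ 'm"
  by (simp add: dot_lmul_matrix)

lemma l1_norm_sign:
  assumes "\<And>i. x $ i \<noteq> 0 \<Longrightarrow> \<sigma> $ i = sgn (x $ i)"
  shows "l1_norm x = \<sigma> \<bullet> x"
  unfolding l1_norm_def inner_vec_def
proof (intro sum.cong refl)
  show "\<bar>x $ i\<bar> = \<sigma> $ i \<bullet> x $ i" for i
    by (cases "x $ i = 0") (simp_all add: assms sgn_if)
qed

text \<open>Along a direction d that vanishes wherever x does, the l1 norm is affine for small t of
  either sign, so g is quadratic there and the subgradient inequality forces equality of the linear
  terms. The entries of \<open>\<sigma>\<close> at zeros of x are free because d is zero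
  there.\<close>

lemma subdifferential_dcen_g_inner:
  fixes A :: "real ^ 'n ^ 'm"
  assumes v: "v \<in> subdifferential (dcen_g A b lam \<gamma>) x"
    and d: "\<And>i. x $ i = 0 \<Longrightarrow> d $ i = 0"
    and \<sigma>: "\<And>i. x $ i \<noteq> 0 \<Longrightarrow> \<sigma> $ i = sgn (x $ i)"
  shows "v \<bullet> d = (transpose A *v (A *v x - b) + (lam * \<gamma>) *\<^sub>R \<sigma> + (3 * lam * (1 - \<gamma>)) *\<^sub>R x) \<bullet> d"
proof -
  have "\<forall>\<^sub>F t in nhds 0. \<bar>x $ i + t * d $ i\<bar> = \<bar>x $ i\<bar> + t * (\<sigma> $ i * d $ i)" for i
  proof (cases "x $ i = 0")
    case False
    have "((\<lambda>t. x $ i + t * d $ i) \<longlongrightarrow> x $ i + 0 * d $ i) (nhds 0)"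
      by (intro tendsto_intros filterlim_ident)
    then have "\<forall>\<^sub>F t in nhds 0. dist (x $ i + t * d $ i) (x $ i) < \<bar>x $ i\<bar>"
      using False by (intro tendstoD) auto
    then show ?thesis
      by eventually_elim (auto simp: dist_real_def \<sigma>[OF False] sgn_if)
  qed (use d in auto)
  then have "\<forall>\<^sub>F t in nhds 0. \<forall>i. \<bar>x $ i + t * d $ i\<bar> = \<bar>x $ i\<bar> + t * (\<sigma> $ i * d $ i)"
    by (intro eventually_all_finite) auto
  then obtain \<tau> where \<tau>: "\<tau> > 0"
    and l1: "\<And>t i. \<bar>t\<bar> < \<tau> \<Longrightarrow> \<bar>x $ i + t * d $ i\<bar> = \<bar>x $ i\<bar> + t * (\<sigma> $ i * d $ i)"
    unfolding eventually_nhds_metric by (auto simp: dist_real_def)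
  define G where "G = transpose A *v (A *v x - b) + (lam * \<gamma>) *\<^sub>R \<sigma> + (3 * lam * (1 - \<gamma>)) *\<^sub>R x"
  define q where "q = 1/2 * (norm (A *v d))\<^sup>2 + 3 * lam * (1 - \<gamma>) / 2 * (norm d)\<^sup>2"
  have "t * ((G - v) \<bullet> d) + t\<^sup>2 * q \<ge> 0" if t: "\<bar>t\<bar> < \<tau>" for t
  proof -
    have e1: "l1_norm (x + t *\<^sub>R d) = l1_norm x + t * (\<sigma> \<bullet> d)"
      unfolding l1_norm_def inner_vec_def sum_distrib_left sum.distrib[symmetric]
      by (intro sum.cong refl) (simp add: l1[OF t])
    have e2: "(norm (A *v (x + t *\<^sub>R d) - b))\<^sup>2 =
        (norm (A *v x - b))\<^sup>2 + 2 * t * ((A *v x - b) \<bullet> (A *v d)) + t\<^sup>2 * (norm (A *v d))\<^sup>2"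
      unfolding power2_norm_eq_inner
      by (simp add: matrix_vector_right_distrib matrix_vector_mult_scaleR inner_simps inner_commute
          algebra_simps power2_eq_square)
    have e3: "(norm (x + t *\<^sub>R d))\<^sup>2 = (norm x)\<^sup>2 + 2 * t * (x \<bullet> d) + t\<^sup>2 * (norm d)\<^sup>2"
      unfolding power2_norm_eq_inner by (simp add: inner_simps inner_commute algebra_simps power2_eq_square)
    have "dcen_g A b lam \<gamma> (x + t *\<^sub>R d) \<ge> dcen_g A b lam \<gamma> x + v \<bullet> (t *\<^sub>R d)"
      using v unfolding subdifferential_def by (auto dest: spec[of _ "x + t *\<^sub>R d"])
    moreover have "dcen_g A b lam \<gamma> (x + t *\<^sub>R d) = dcen_g A b lam \<gamma> x + t * (G \<bullet> d) + t\<^sup>2 * q"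
      unfolding dcen_g_def e1 e2 e3 G_def q_def inner_add_left transpose_inner inner_scaleR_left
      by (simp add: field_simps)
    ultimately show ?thesis by (simp add: inner_diff_left algebra_simps)
  qed
  with \<tau> have "(G - v) \<bullet> d = 0" by (rule linear_coefficient_zero)
  then show ?thesis unfolding G_def[symmetric] by (simp add: inner_diff_left)
qed

text \<open>The point z may lie on the boundary of the face: \<open>\<sigma>\<close> is tied to z
  only on the support of z, and there \<open>l1_norm z = \<sigma> \<bullet> z\<close> still holds,
  so the same smooth formula covers z and the nearby x.\<close>

lemma dcen_H_lojasiewicz_face:
  fixes A :: "real ^ 'n ^ 'm" and z \<sigma> :: "real ^ 'n"
  assumes par: "0 < \<alpha>" "0 < lam" "0 < \<gamma>" "\<gamma> < 1"
    and z: "z \<noteq> 0" and \<sigma>z: "\<And>i. z $ i \<noteq> 0 \<Longrightarrow> \<sigma> $ i = sgn (z $ i)"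
  shows "\<forall>\<^sub>F \<eta> in at_right 0. \<forall>x v. dist x z < \<eta> \<longrightarrow> (\<forall>i. \<sigma> $ i = sgn (x $ i)) \<longrightarrow>
           v \<in> subdifferential (dcen_g A b lam \<gamma>) x \<longrightarrow> norm (v - lam *\<^sub>R d_l2 \<alpha> \<gamma> x) < \<eta> \<longrightarrow>
           \<bar>dcen_H A b lam \<alpha> \<gamma> x - dcen_H A b lam \<alpha> \<gamma> z\<bar> \<le> norm (v - lam *\<^sub>R d_l2 \<alpha> \<gamma> x) powr (1 + \<eta>)"
proof -
  define V where "V = {y :: real ^ 'n. \<forall>i. \<sigma> $ i = 0 \<longrightarrow> y $ i = 0}"
  define pr where "pr y = (\<chi> i. if \<sigma> $ i = 0 then 0 else y $ i)" for y :: "real ^ 'n"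
  \<comment> \<open>The Hessian of the quadratic part of H; p is the linear part on the face. V is
    the tangent space of the face and pr the orthogonal projection onto it.\<close>
  define Q where "Q y = transpose A *v (A *v y) + (2 * lam * (1 - \<gamma>)) *\<^sub>R y" for y
  define p where "p = (lam * \<gamma>) *\<^sub>R \<sigma> - transpose A *v b"
  define c where "c = lam * \<alpha> * \<gamma>"
  have c: "c > 0" using par by (simp add: c_def)
  have V: "subspace V" by (auto simp: V_def subspace_def)
  have pr: "pr y \<bullet> x = y \<bullet> x" if "x \<in> V" for x y
    unfolding inner_vec_def using that by (intro sum.cong) (auto simp: pr_def V_def)
  have Q_inner: "Q y \<bullet> x = (A *v y) \<bullet> (A *v x) + 2 * lam * (1 - \<gamma>) * (y \<bullet> x)" for x y
    by (simp add: Q_def inner_add_left dot_lmul_matrix)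
  have "linear (\<lambda>y. pr (Q y))"
    by (rule linearI)
      (auto simp: pr_def Q_def vec_eq_iff matrix_vector_right_distrib matrix_vector_mult_scaleR algebra_simps)
  moreover have "pr (Q y) \<in> V" for y by (simp add: pr_def V_def)
  moreover have "pr (Q x) \<bullet> y = x \<bullet> pr (Q y)" if "x \<in> V" "y \<in> V" for x y
    using that by (simp add: pr inner_commute[of x] Q_inner) (simp add: inner_commute)
  ultimately have "\<exists>B \<mu>. pairwise orthogonal B \<and> span B = V \<and>
      (\<forall>e\<in>B. norm e = 1 \<and> pr (Q e) = \<mu> e *\<^sub>R e)"
    using V by (intro self_adjoint_eigenbasis)
  then obtain B \<mu> where B: "pairwise orthogonal B" "span B = V"
    and eig: "\<And>e. e \<in> B \<Longrightarrow> norm e = 1 \<and> pr (Q e) = \<mu> e *\<^sub>R e"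
    by blast
  have B1: "norm e = 1" if "e \<in> B" for e using eig[OF that] by simp
  have BV: "e \<in> V" if "e \<in> B" for e using B(2) that span_base by blast
  have eQ: "e \<bullet> Q x = \<mu> e * (e \<bullet> x)" if "e \<in> B" "x \<in> V" for e x
  proof -
    have "e \<bullet> Q x = Q e \<bullet> x" by (simp add: inner_commute[of e] Q_inner) (simp add: inner_commute)
    also have "\<dots> = pr (Q e) \<bullet> x" using pr[OF that(2)] by simp
    finally show ?thesis using eig[OF that(1)] by simp
  qed
  have \<mu>: "\<mu> e > 0" if "e \<in> B" for e
  proof -
    have "\<mu> e = e \<bullet> Q e" using eQ[OF that BV[OF that]] B1[OF that] by (simp add: norm_eq_1)
    also have "\<dots> = (norm (A *v e))\<^sup>2 + 2 * lam * (1 - \<gamma>)"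
      using B1[OF that] by (simp add: inner_commute[of e "Q e"] Q_inner power2_norm_eq_inner norm_eq_1)
    also have "\<dots> > 0" using par by (intro add_nonneg_pos) auto
    finally show ?thesis .
  qed
  define f where "f x = (\<Sum>e\<in>B. \<mu> e * (e \<bullet> x)\<^sup>2 / 2 + (e \<bullet> p) * (e \<bullet> x)) - c * norm x" for x
  have Hf: "dcen_H A b lam \<alpha> \<gamma> x = (norm b)\<^sup>2 / 2 + f x" if xV: "x \<in> V" and l1: "l1_norm x = \<sigma> \<bullet> x" for x
  proof -
    have "(\<Sum>e\<in>B. \<mu> e * (e \<bullet> x)\<^sup>2 / 2) = (\<Sum>e\<in>B. (e \<bullet> x) * (e \<bullet> Q x)) / 2"
      unfolding sum_divide_distrib using eQ xV by (intro sum.cong) (auto simp: power2_eq_square)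
    also have "\<dots> = x \<bullet> Q x / 2" using orthonormal_inner[OF B(1) B1, of x "Q x"] xV B(2) by simp
    also have "\<dots> = (norm (A *v x))\<^sup>2 / 2 + lam * (1 - \<gamma>) * (norm x)\<^sup>2"
      by (simp add: inner_commute[of x "Q x"] Q_inner power2_norm_eq_inner)
    finally have 1: "(\<Sum>e\<in>B. \<mu> e * (e \<bullet> x)\<^sup>2 / 2) = (norm (A *v x))\<^sup>2 / 2 + lam * (1 - \<gamma>) * (norm x)\<^sup>2" .
    have "(\<Sum>e\<in>B. (e \<bullet> p) * (e \<bullet> x)) = x \<bullet> p"
      using orthonormal_inner[OF B(1) B1, of x p] xV B(2) by (simp add: mult.commute)
    also have "\<dots> = lam * \<gamma> * l1_norm x - b \<bullet> (A *v x)"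
      unfolding l1 inner_commute[of x p] unfolding p_def by (simp add: inner_diff_left dot_lmul_matrix)
    finally have 2: "(\<Sum>e\<in>B. (e \<bullet> p) * (e \<bullet> x)) = lam * \<gamma> * l1_norm x - b \<bullet> (A *v x)" .
    have 3: "(norm (A *v x - b))\<^sup>2 = (norm (A *v x))\<^sup>2 - 2 * (b \<bullet> (A *v x)) + (norm b)\<^sup>2"
      unfolding power2_norm_eq_inner by (simp add: inner_simps inner_commute)
    show ?thesis
      unfolding dcen_H_def f_def sum.distrib 1 2 3 c_def by (simp add: algebra_simps)
  qed
  have "z $ i = 0" if "\<sigma> $ i = 0" for i
    using \<sigma>z[of i] that by (cases "z $ i = 0") (auto simp: sgn_0_0)
  then have zV: "z \<in> V" by (simp add: V_def)
  have Hz: "dcen_H A b lam \<alpha> \<gamma> z = (norm b)\<^sup>2 / 2 + f z"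
    using Hf[OF zV l1_norm_sign[OF \<sigma>z]] by simp
  have "\<forall>\<^sub>F \<eta> in at_right 0. \<forall>x e. dist x z < \<eta> \<longrightarrow> 0 \<le> e \<longrightarrow> e < \<eta> \<longrightarrow>
           x \<in> span B \<and> (\<forall>a\<in>B. \<bar>(\<mu> a - c / norm x) * (a \<bullet> x) + a \<bullet> p\<bar> \<le> e) \<longrightarrow>
           \<bar>f x - f z\<bar> \<le> e powr (1 + \<eta>)"
    unfolding f_def using B1 \<mu> zV z B(2) by (intro secular_lojasiewicz[OF B(1) _ _ c]) auto
  \<comment> \<open>Keeps x away from the origin, where the formula for \<open>d_l2\<close> carries
    no gradient information.\<close>
  moreover have "\<forall>\<^sub>F \<eta> in at_right 0. \<eta> < norm z"
    unfolding eventually_at_right_field using z by (intro exI[of _ "norm z"]) auto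
  ultimately show ?thesis
  proof (eventually_elim, intro allI impI)
    fix \<eta> x v
    assume L: "\<forall>x e. dist x z < \<eta> \<longrightarrow> 0 \<le> e \<longrightarrow> e < \<eta> \<longrightarrow>
           x \<in> span B \<and> (\<forall>a\<in>B. \<bar>(\<mu> a - c / norm x) * (a \<bullet> x) + a \<bullet> p\<bar> \<le> e) \<longrightarrow>
           \<bar>f x - f z\<bar> \<le> e powr (1 + \<eta>)"
      and \<eta>: "\<eta> < norm z"
      and x: "dist x z < \<eta>" and \<sigma>x: "\<forall>i. \<sigma> $ i = sgn (x $ i)"
      and v: "v \<in> subdifferential (dcen_g A b lam \<gamma>) x"
      and small: "norm (v - lam *\<^sub>R d_l2 \<alpha> \<gamma> x) < \<eta>"
    have x0: "x \<noteq> 0" using x \<eta> by (auto simp: dist_norm)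
    have xV: "x \<in> V" using \<sigma>x by (auto simp: V_def sgn_0_0)
    have "(\<mu> a - c / norm x) * (a \<bullet> x) + a \<bullet> p = (v - lam *\<^sub>R d_l2 \<alpha> \<gamma> x) \<bullet> a" if "a \<in> B" for a
    proof -
      have "v \<bullet> a = (transpose A *v (A *v x - b) + (lam * \<gamma>) *\<^sub>R \<sigma> + (3 * lam * (1 - \<gamma>)) *\<^sub>R x) \<bullet> a"
        using BV[OF that] \<sigma>x by (intro subdifferential_dcen_g_inner[OF v]) (auto simp: V_def)
      \<comment> \<open>The surplus \<open>lam * (1 - \<gamma>) * (a \<bullet> x)\<close> is the
        difference between the coefficient 3 in g and the 2 in Q; subtracting
        \<open>lam *\<^sub>R d_l2 \<alpha> \<gamma> x\<close> removes it.\<close>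
      also have "\<dots> = a \<bullet> Q x + a \<bullet> p + lam * (1 - \<gamma>) * (a \<bullet> x)"
        unfolding inner_commute[of a] Q_inner p_def
        by (simp add: inner_add_left inner_diff_left dot_lmul_matrix algebra_simps)
      finally show ?thesis
        using eQ[OF that xV] x0
        by (simp add: inner_diff_left d_l2_def c_def inner_commute algebra_simps add_divide_distrib diff_divide_distrib)
    qed
    then have "\<bar>(\<mu> a - c / norm x) * (a \<bullet> x) + a \<bullet> p\<bar> \<le> norm (v - lam *\<^sub>R d_l2 \<alpha> \<gamma> x)" if "a \<in> B" for a
      using Cauchy_Schwarz_ineq2[of "v - lam *\<^sub>R d_l2 \<alpha> \<gamma> x" a] B1[OF that] that by simp
    then have "\<bar>f x - f z\<bar> \<le> norm (v - lam *\<^sub>R d_l2 \<alpha> \<gamma> x) powr (1 + \<eta>)"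
      using L x small xV B(2) by simp
    moreover have "dcen_H A b lam \<alpha> \<gamma> x = (norm b)\<^sup>2 / 2 + f x"
      using \<sigma>x by (intro Hf xV l1_norm_sign) auto
    ultimately show "\<bar>dcen_H A b lam \<alpha> \<gamma> x - dcen_H A b lam \<alpha> \<gamma> z\<bar> \<le> norm (v - lam *\<^sub>R d_l2 \<alpha> \<gamma> x) powr (1 + \<eta>)"
      using Hz by simp
  qed
qed

text \<open>Close to z no nonzero coordinate changes sign, so x lies on one of the finitely many
  faces whose sign pattern extends that of z.\<close>

lemma dcen_H_lojasiewicz:
  fixes A :: "real ^ 'n ^ 'm" and z :: "real ^ 'n"
  assumes par: "0 < \<alpha>" "0 < lam" "0 < \<gamma>" "\<gamma> < 1" and z: "z \<noteq> 0"
  shows "\<forall>\<^sub>F \<eta> in at_right 0. \<forall>x v. dist x z < \<eta> \<longrightarrow>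
           v \<in> subdifferential (dcen_g A b lam \<gamma>) x \<longrightarrow> norm (v - lam *\<^sub>R d_l2 \<alpha> \<gamma> x) < \<eta> \<longrightarrow>
           \<bar>dcen_H A b lam \<alpha> \<gamma> x - dcen_H A b lam \<alpha> \<gamma> z\<bar> \<le> norm (v - lam *\<^sub>R d_l2 \<alpha> \<gamma> x) powr (1 + \<eta>)"
proof -
  \<comment> \<open>Passing through extensional functions into {-1, 0, 1} makes the finiteness of
    the set of sign vectors immediate.\<close>
  define S where "S = {\<sigma> \<in> (\<lambda>s. \<chi> i. s i) ` ((UNIV :: 'n set) \<rightarrow>\<^sub>E {-1, 0, 1 :: real}).
    \<forall>i. z $ i \<noteq> 0 \<longrightarrow> \<sigma> $ i = sgn (z $ i)}"
  have "finite ((\<lambda>s. \<chi> i. s i) ` ((UNIV :: 'n set) \<rightarrow>\<^sub>E {-1, 0, 1 :: real}))"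
    by (intro finite_imageI finite_PiE) auto
  then have "finite S" by (rule rev_finite_subset) (auto simp: S_def)
  have "\<forall>\<^sub>F \<eta> in at_right 0. \<forall>\<sigma>\<in>S. \<forall>x v. dist x z < \<eta> \<longrightarrow> (\<forall>i. \<sigma> $ i = sgn (x $ i)) \<longrightarrow>
           v \<in> subdifferential (dcen_g A b lam \<gamma>) x \<longrightarrow> norm (v - lam *\<^sub>R d_l2 \<alpha> \<gamma> x) < \<eta> \<longrightarrow>
           \<bar>dcen_H A b lam \<alpha> \<gamma> x - dcen_H A b lam \<alpha> \<gamma> z\<bar> \<le> norm (v - lam *\<^sub>R d_l2 \<alpha> \<gamma> x) powr (1 + \<eta>)"
    using dcen_H_lojasiewicz_face[OF par z]
    by (intro eventually_ball_finite \<open>finite S\<close> ballI) (auto simp: S_def)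
  moreover have "\<forall>\<^sub>F \<eta> in at_right 0. \<forall>i. z $ i \<noteq> 0 \<longrightarrow> \<eta> < \<bar>z $ i\<bar>"
  proof (intro eventually_all_finite)
    show "\<forall>\<^sub>F \<eta> in at_right 0. z $ i \<noteq> 0 \<longrightarrow> \<eta> < \<bar>z $ i\<bar>" for i
      unfolding eventually_at_right_field by (cases "z $ i = 0") (auto intro: exI[of _ "\<bar>z $ i\<bar>"] exI[of _ 1])
  qed
  ultimately show ?thesis
  proof (eventually_elim, intro allI impI)
    fix \<eta> x v
    assume L: "\<forall>\<sigma>\<in>S. \<forall>x v. dist x z < \<eta> \<longrightarrow> (\<forall>i. \<sigma> $ i = sgn (x $ i)) \<longrightarrow>
           v \<in> subdifferential (dcen_g A b lam \<gamma>) x \<longrightarrow> norm (v - lam *\<^sub>R d_l2 \<alpha> \<gamma> x) < \<eta> \<longrightarrow>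
           \<bar>dcen_H A b lam \<alpha> \<gamma> x - dcen_H A b lam \<alpha> \<gamma> z\<bar> \<le> norm (v - lam *\<^sub>R d_l2 \<alpha> \<gamma> x) powr (1 + \<eta>)"
      and \<eta>: "\<forall>i. z $ i \<noteq> 0 \<longrightarrow> \<eta> < \<bar>z $ i\<bar>" and x: "dist x z < \<eta>"
      and v: "v \<in> subdifferential (dcen_g A b lam \<gamma>) x" "norm (v - lam *\<^sub>R d_l2 \<alpha> \<gamma> x) < \<eta>"
    have "sgn (x $ i) = sgn (z $ i)" if "z $ i \<noteq> 0" for i
    proof -
      have "\<bar>x $ i - z $ i\<bar> < \<bar>z $ i\<bar>"
        using dist_vec_nth_le[of x i z] x \<eta> that by (force simp: dist_real_def)
      then show ?thesis by (auto simp: sgn_if)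
    qed
    moreover have "(\<chi> i. sgn (x $ i)) \<in> (\<lambda>s. \<chi> i. s i) ` ((UNIV :: 'n set) \<rightarrow>\<^sub>E {-1, 0, 1 :: real})"
      by (rule image_eqI[of _ _ "\<lambda>i. sgn (x $ i)"]) (auto simp: sgn_if split: if_splits)
    ultimately have "(\<chi> i. sgn (x $ i)) \<in> S" by (simp add: S_def)
    from L[rule_format, OF this x _ v]
    show "\<bar>dcen_H A b lam \<alpha> \<gamma> x - dcen_H A b lam \<alpha> \<gamma> z\<bar> \<le> norm (v - lam *\<^sub>R d_l2 \<alpha> \<gamma> x) powr (1 + \<eta>)"
      by simp
  qed
qed

section \<open>Convergence of descent sequences\<close>

text \<open>The weighted arithmetic-geometric mean inequality for e' and e with weights q and 1 - q,
  multiplied by \<open>e powr (q - 1)\<close>.\<close>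

lemma powr_concave_tangent:
  fixes e e' q :: real
  assumes "0 < q" "q < 1" "e > 0" "e' \<ge> 0"
  shows "q * e powr (q - 1) * (e - e') \<le> e powr q - e' powr q"
proof (cases "e' = 0")
  case True
  have "e powr q = e powr (q - 1) * e"
    using assms powr_mult_base[of e "q - 1"] by (simp add: mult.commute)
  moreover have "q * (e powr (q - 1) * e) \<le> 1 * (e powr (q - 1) * e)"
    using assms by (intro mult_right_mono) auto
  ultimately show ?thesis using True by simp
next
  case False
  then have "e' powr q * e powr (1 - q) \<le> q * e' + (1 - q) * e"
    using assms by (intro Youngs_inequality_0) auto
  then have "e powr (q - 1) * (e' powr q * e powr (1 - q)) \<le> e powr (q - 1) * (q * e' + (1 - q) * e)"
    by (intro mult_left_mono) auto
  moreover have "e powr (q - 1) * e powr (1 - q) = 1"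
    using assms by (simp flip: powr_add)
  moreover have "e powr q = e powr (q - 1) * e"
    using assms powr_mult_base[of e "q - 1"] by (simp add: mult.commute)
  ultimately show ?thesis by (simp add: algebra_simps)
qed

text \<open>The desingularizing function is \<open>s powr q\<close> with \<open>q = \<eta> / (1 + \<eta>)\<close>: its decrease along the
  sequence bounds \<open>(D (Suc k))\<^sup>2 / D k\<close>, and the arithmetic-geometric mean inequality makes this
  summable.\<close>

lemma lojasiewicz_descent_summable:
  fixes e D :: "nat \<Rightarrow> real"
  assumes e: "\<And>k. e k \<ge> 0" and D: "\<And>k. D k \<ge> 0" and a: "a > 0" and L: "L > 0" and \<eta>: "\<eta> > 0"
    and descent: "\<And>k. e (Suc k) + a * (D k)\<^sup>2 \<le> e k"
    and loj: "\<forall>\<^sub>F k in sequentially. e (Suc k) \<le> (L * D k) powr (1 + \<eta>)"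
  shows "summable D"
proof -
  define q where "q = \<eta> / (1 + \<eta>)"
  have q: "0 < q" "q < 1" using \<eta> by (auto simp: q_def field_simps)
  \<comment> \<open>The reason for this q: raising the Lojasiewicz bound to the power 1 - q makes it
    linear in \<open>D k\<close>.\<close>
  have q1: "(1 + \<eta>) * (1 - q) = 1" using \<eta> by (simp add: q_def field_simps)
  define \<phi> where "\<phi> k = e k powr q" for k
  define M where "M = L / (q * a)"
  have M: "M > 0" using L q a by (simp add: M_def)
  obtain K where K: "\<And>k. k \<ge> K \<Longrightarrow> e (Suc k) \<le> (L * D k) powr (1 + \<eta>)"
    using loj unfolding eventually_sequentially by blast
  have step: "2 * D (Suc k) \<le> D k + M * (\<phi> (Suc k) - \<phi> (Suc (Suc k)))" if k: "k \<ge> K" for k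
  proof (cases "e (Suc k) = 0")
    case True
    have "a * (D (Suc k))\<^sup>2 \<ge> 0" using a by simp
    then have 0: "e (Suc (Suc k)) = 0" "a * (D (Suc k))\<^sup>2 = 0"
      using descent[of "Suc k"] True e[of "Suc (Suc k)"] by linarith+
    then show ?thesis using True D[of k] a by (simp add: \<phi>_def)
  next
    case False
    then have e1: "e (Suc k) > 0" using e[of "Suc k"] by simp
    have Dk: "D k > 0" using K[OF k] e1 D[of k] by (cases "D k = 0") auto
    have "e (Suc k) powr (1 - q) \<le> ((L * D k) powr (1 + \<eta>)) powr (1 - q)"
      using K[OF k] e1 q by (intro powr_mono2) auto
    also have "\<dots> = L * D k" using q1 L Dk by (simp add: powr_powr)
    finally have b: "e (Suc k) powr (1 - q) \<le> L * D k" .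
    define E where "E = e (Suc k) powr (q - 1)"
    define d where "d = \<phi> (Suc k) - \<phi> (Suc (Suc k))"
    have "E * e (Suc k) powr (1 - q) = 1" "E > 0"
      using e1 by (auto simp: E_def simp flip: powr_add)
    then have E1: "1 \<le> E * (L * D k)" using mult_left_mono[OF b, of E] by simp
    have "q * E * (e (Suc k) - e (Suc (Suc k))) \<le> d"
      unfolding E_def d_def \<phi>_def by (rule powr_concave_tangent[OF q e1 e])
    moreover have "q * E * (a * (D (Suc k))\<^sup>2) \<le> q * E * (e (Suc k) - e (Suc (Suc k)))"
      using descent[of "Suc k"] q \<open>E > 0\<close> by (intro mult_left_mono) auto
    ultimately have qd: "q * E * (a * (D (Suc k))\<^sup>2) \<le> d" by linarith
    have "q * a * (D (Suc k))\<^sup>2 * 1 \<le> q * a * (D (Suc k))\<^sup>2 * (E * (L * D k))"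
      using E1 q a by (intro mult_left_mono) auto
    also have "\<dots> = (L * D k) * (q * E * (a * (D (Suc k))\<^sup>2))" by (simp add: algebra_simps)
    also have "\<dots> \<le> (L * D k) * d" using qd L Dk by (intro mult_left_mono) auto
    finally have sq: "(D (Suc k))\<^sup>2 \<le> D k * (M * d)"
      using q a by (simp add: M_def field_simps)
    have "d \<ge> 0" using qd q a \<open>E > 0\<close> by (meson mult_nonneg_nonneg less_imp_le order_trans zero_le_power2)
    have "(2 * D (Suc k))\<^sup>2 \<le> 4 * (D k * (M * d))" using sq by (simp add: power2_eq_square)
    also have "\<dots> \<le> (D k + M * d)\<^sup>2"
      using zero_le_power2[of "D k - M * d"] by (simp add: power2_eq_square algebra_simps)
    finally have "2 * D (Suc k) \<le> D k + M * d"
      by (rule power2_le_imp_le) (use Dk M \<open>d \<ge> 0\<close> in auto)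
    then show ?thesis by (simp add: d_def)
  qed
  \<comment> \<open>The factor 2 in \<open>step\<close> drives the induction: one copy of
    \<open>D (Suc k)\<close> joins the sum, the other takes the place of \<open>D k\<close>, and the
    \<open>\<phi>\<close> terms telescope.\<close>
  have bound: "(\<Sum>j<n. D (Suc (K + j))) + D (K + n) + M * \<phi> (Suc (K + n)) \<le> D K + M * \<phi> (Suc K)" for n
  proof (induction n)
    case (Suc n)
    then show ?case using step[of "K + n"] by (simp add: algebra_simps)
  qed simp
  have M\<phi>: "M * \<phi> k \<ge> 0" for k
    using M by (simp add: \<phi>_def)
  have "(\<Sum>j<n. D (Suc (K + j))) \<le> D K + M * \<phi> (Suc K)" for n
    using bound[of n] D[of "K + n"] M\<phi>[of "Suc (K + n)"] by linarith
  then have "summable (\<lambda>j. D (j + Suc K))"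
    using D by (intro summableI_nonneg_bounded) (auto simp: add.commute)
  then show ?thesis by (simp only: summable_iff_shift)
qed

section \<open>Subgradients, continuity and growth of g, h and H\<close>

lemma subdifferential_limit:
  fixes f :: "'a::real_inner \<Rightarrow> real"
  assumes "continuous_on UNIV f" and sub: "\<And>n. v n \<in> subdifferential f (x n)"
    and x: "x \<longlonglongrightarrow> x'" and v: "v \<longlonglongrightarrow> v'"
  shows "v' \<in> subdifferential f x'"
  unfolding subdifferential_def
proof (intro CollectI allI)
  fix y
  have "isCont f x'" using assms(1) by (simp add: continuous_on_eq_continuous_at)
  then have "(\<lambda>n. f (x n) + v n \<bullet> (y - x n)) \<longlonglongrightarrow> f x' + v' \<bullet> (y - x')"
    by (intro tendsto_intros x v isCont_tendsto_compose[of x' f])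
  then show "f x' + v' \<bullet> (y - x') \<le> f y"
    by (rule LIMSEQ_le_const2) (use sub in \<open>auto simp: subdifferential_def\<close>)
qed

lemma continuous_on_l1_norm: "continuous_on S l1_norm"
  unfolding l1_norm_def[abs_def] by (intro continuous_intros)

lemma continuous_on_dcen_g: "continuous_on S (dcen_g A b lam \<gamma>)"
  unfolding dcen_g_def[abs_def]
  by (intro continuous_intros continuous_on_l1_norm matrix_vector_mult_linear_continuous_on)

lemma continuous_on_dcen_h: "continuous_on S (dcen_h lam \<alpha> \<gamma>)"
  unfolding dcen_h_def[abs_def] by (intro continuous_intros)

lemma continuous_on_dcen_H: "continuous_on S (dcen_H A b lam \<alpha> \<gamma>)"
  unfolding dcen_H_eq_diff[abs_def]
  by (intro continuous_intros continuous_on_dcen_g continuous_on_dcen_h)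

text \<open>Serves to discard the quadratic parts of g and h once a subgradient inequality at 0,
  tested at \<open>t *\<^sub>R y\<close>, has been divided by t.\<close>

lemma le_of_le_add_scaled:
  fixes a b K :: real
  assumes "\<And>t. t > 0 \<Longrightarrow> a \<le> b + t * K"
  shows "a \<le> b"
proof -
  have "((\<lambda>t. b + t * K) \<longlongrightarrow> b + 0 * K) (at_right 0)"
    by (intro tendsto_intros)
  moreover have "\<forall>\<^sub>F t in at_right 0. a \<le> b + t * K"
    using assms by (simp add: eventually_at_right_field) (auto intro: exI[of _ 1])
  ultimately show ?thesis
    using tendsto_lowerbound[of "\<lambda>t. b + t * K" "b + 0 * K" "at_right 0" a] by simp
qed

text \<open>Cauchy-Schwarz handles the norm, and the quadratic part contributes an exact remainder.
  The case x = 0 is included, as \<open>d_l2\<close> gives 0 there, a subgradient of h at 0; this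
  merges the two branches of the algorithm.\<close>

lemma dcen_h_strong_subgradient:
  assumes "0 < \<alpha>" "0 < lam" "0 < \<gamma>"
  shows "dcen_h lam \<alpha> \<gamma> y \<ge> dcen_h lam \<alpha> \<gamma> x + (lam *\<^sub>R d_l2 \<alpha> \<gamma> x) \<bullet> (y - x)
           + lam * (1 - \<gamma>) / 2 * (norm (y - x))\<^sup>2"
proof -
  define r where "r = x \<bullet> (y - x) / norm x"
  have "norm x + r \<le> norm y"
  proof (cases "x = 0")
    case False
    have "r + norm x = (x \<bullet> y) / norm x"
      using False by (simp add: r_def inner_diff_right field_simps power2_eq_square flip: power2_norm_eq_inner)
    also have "\<dots> \<le> norm y"
      using norm_cauchy_schwarz[of x y] False by (simp add: field_simps)
    finally show ?thesis by simp
  qed (simp add: r_def)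
  then have "lam * (\<alpha> * \<gamma> * (norm x + r)) \<le> lam * (\<alpha> * \<gamma> * norm y)"
    using assms by (intro mult_left_mono) auto
  moreover have "(lam *\<^sub>R d_l2 \<alpha> \<gamma> x) \<bullet> (y - x) = lam * (\<alpha> * \<gamma> * r) + lam * (1 - \<gamma>) * (x \<bullet> (y - x))"
  proof -
    have "lam * ((\<alpha> * \<gamma> / n + 1 - \<gamma>) * p) = lam * (\<alpha> * \<gamma> * (p / n)) + lam * (1 - \<gamma>) * p" for n p
      by (simp add: algebra_simps)
    then show ?thesis unfolding d_l2_def r_def inner_scaleR_left .
  qed
  moreover have "(norm y)\<^sup>2 = (norm x)\<^sup>2 + 2 * (x \<bullet> (y - x)) + (norm (y - x))\<^sup>2"
    unfolding power2_norm_eq_inner by (simp add: inner_simps inner_commute)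
  ultimately show ?thesis
    unfolding dcen_h_def by (simp add: field_simps)
qed

lemma d_l2_subgradient_dcen_h:
  assumes "0 < \<alpha>" "0 < lam" "0 < \<gamma>" "\<gamma> < 1"
  shows "lam *\<^sub>R d_l2 \<alpha> \<gamma> x \<in> subdifferential (dcen_h lam \<alpha> \<gamma>) x"
  unfolding subdifferential_def
proof (intro CollectI allI)
  fix y
  have "lam * (1 - \<gamma>) / 2 * (norm (y - x))\<^sup>2 \<ge> 0" using assms by (intro mult_nonneg_nonneg) auto
  then show "dcen_h lam \<alpha> \<gamma> x + lam *\<^sub>R d_l2 \<alpha> \<gamma> x \<bullet> (y - x) \<le> dcen_h lam \<alpha> \<gamma> y"
    using dcen_h_strong_subgradient[OF assms(1-3), of x y] by linarith
qed

lemma norm_d_l2_le: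
  assumes "0 < \<alpha>" "0 < lam" "0 < \<gamma>" "\<gamma> < 1"
  shows "norm (lam *\<^sub>R d_l2 \<alpha> \<gamma> x) \<le> lam * (\<alpha> * \<gamma> + norm x)"
proof -
  have "\<alpha> * \<gamma> / norm x \<ge> 0" using assms by simp
  then have "\<alpha> * \<gamma> / norm x + 1 - \<gamma> \<ge> 0" using assms by linarith
  then have "norm (d_l2 \<alpha> \<gamma> x) = \<alpha> * \<gamma> / norm x * norm x + (1 - \<gamma>) * norm x"
    unfolding d_l2_def norm_scaleR by (simp add: algebra_simps)
  also have "\<dots> \<le> \<alpha> * \<gamma> + norm x"
    using assms by (intro add_mono) (auto simp: mult_left_le_one_le)
  finally show ?thesis using assms by simp
qed

text \<open>Normalization to unit length is Lipschitz with constant \<open>2 / \<rho>\<close>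
  outside the ball of radius \<open>\<rho>\<close>; one half comes from the difference of the
  vectors, the other from the difference of their norms.\<close>

lemma d_l2_lipschitz:
  assumes "0 < \<alpha>" "0 < \<gamma>" "\<gamma> < 1" and \<rho>: "\<rho> > 0" "\<rho> \<le> norm x" "\<rho> \<le> norm y"
  shows "norm (d_l2 \<alpha> \<gamma> x - d_l2 \<alpha> \<gamma> y) \<le> (2 * \<alpha> * \<gamma> / \<rho> + 1) * norm (x - y)"
proof -
  have n: "norm x > 0" "norm y > 0" using \<rho> by linarith+
  have "norm (x /\<^sub>R norm x - y /\<^sub>R norm y)
      = norm ((x - y) /\<^sub>R norm x + ((norm y - norm x) / (norm x * norm y)) *\<^sub>R y)"
    using n by (intro arg_cong[of _ _ norm])
      (simp add: scaleR_diff_right diff_divide_distrib scaleR_diff_left inverse_eq_divide)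
  also have "\<dots> \<le> norm (x - y) / norm x + \<bar>norm y - norm x\<bar> / norm x"
  proof -
    have "norm ((x - y) /\<^sub>R norm x) = norm (x - y) / norm x"
      by (simp add: divide_inverse mult.commute)
    moreover have "norm (((norm y - norm x) / (norm x * norm y)) *\<^sub>R y) = \<bar>norm y - norm x\<bar> / norm x"
      using n by simp
    ultimately show ?thesis by (metis norm_triangle_ineq)
  qed
  also have "\<dots> \<le> norm (x - y) / \<rho> + norm (x - y) / \<rho>"
    using norm_triangle_ineq3[of y x] \<rho> n
    by (intro add_mono frac_le) (auto simp: norm_minus_commute)
  finally have "norm (x /\<^sub>R norm x - y /\<^sub>R norm y) \<le> 2 / \<rho> * norm (x - y)" by simp
  then have 1: "\<alpha> * \<gamma> * norm (x /\<^sub>R norm x - y /\<^sub>R norm y) \<le> \<alpha> * \<gamma> * (2 / \<rho> * norm (x - y))"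
    using assms by (intro mult_left_mono) auto
  have "d_l2 \<alpha> \<gamma> x - d_l2 \<alpha> \<gamma> y = (\<alpha> * \<gamma>) *\<^sub>R (x /\<^sub>R norm x - y /\<^sub>R norm y) + (1 - \<gamma>) *\<^sub>R (x - y)"
    by (simp add: d_l2_def algebra_simps divide_inverse)
  then have "norm (d_l2 \<alpha> \<gamma> x - d_l2 \<alpha> \<gamma> y)
      \<le> \<alpha> * \<gamma> * norm (x /\<^sub>R norm x - y /\<^sub>R norm y) + (1 - \<gamma>) * norm (x - y)"
    using norm_triangle_ineq[of "(\<alpha> * \<gamma>) *\<^sub>R (x /\<^sub>R norm x - y /\<^sub>R norm y)" "(1 - \<gamma>) *\<^sub>R (x - y)"] assms
    by simp
  also have "\<dots> \<le> \<alpha> * \<gamma> * (2 / \<rho> * norm (x - y)) + 1 * norm (x - y)"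
    using 1 assms by (intro add_mono mult_right_mono) auto
  finally show ?thesis by (simp add: algebra_simps)
qed

text \<open>The sparsity term is nonnegative because the Euclidean norm is at most the l1 norm and
  \<open>\<alpha>\<close> is below 1.\<close>

lemma dcen_H_coercive:
  assumes "0 < \<alpha>" "\<alpha> < 1" "0 < lam" "0 < \<gamma>"
  shows "lam * (1 - \<gamma>) * (norm x)\<^sup>2 \<le> dcen_H A b lam \<alpha> \<gamma> x"
proof -
  have "\<alpha> * norm x \<le> 1 * norm x" using assms by (intro mult_right_mono) auto
  also have "\<dots> \<le> l1_norm x" unfolding l1_norm_def using norm_le_l1_cart by simp
  finally have "0 \<le> lam * (\<gamma> * (l1_norm x - \<alpha> * norm x))" using assms by simp
  moreover have "0 \<le> 1/2 * (norm (A *v x - b))\<^sup>2" by simp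
  ultimately show ?thesis unfolding dcen_H_def distrib_left[of lam] by (simp add: mult.assoc)
qed

text \<open>Carries the disjointness hypothesis, which concerns the positively homogeneous parts,
  over to g and h themselves. To first order at 0 the functions g and h differ from those parts only
  by the linear term \<open>- b \<bullet> (A *v y)\<close> and a constant. Testing along rays gives
  the inclusion directly, without a sum rule for subdifferentials.\<close>

lemma dcen_subgradient_at_zero:
  fixes A :: "real ^ 'n ^ 'm"
  assumes w: "w \<in> subdifferential (dcen_g A b lam \<gamma>) 0" "w \<in> subdifferential (dcen_h lam \<alpha> \<gamma>) 0"
  shows "w \<in> (\<lambda>v. - (transpose A *v b) + v) ` subdifferential (\<lambda>y. lam * \<gamma> * l1_norm y) 0
           \<inter> subdifferential (\<lambda>y. lam * \<alpha> * \<gamma> * norm y) 0"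
proof -
  have l0: "l1_norm (0 :: real ^ 'n) = 0" by (simp add: l1_norm_def)
  have l1: "l1_norm (t *\<^sub>R y) = t * l1_norm y" if "t > 0" for t and y :: "real ^ 'n"
    using that by (simp add: l1_norm_def abs_mult sum_distrib_left)
  have "w \<bullet> y \<le> lam * \<alpha> * \<gamma> * norm y" for y
  proof (rule le_of_le_add_scaled)
    fix t :: real assume t: "t > 0"
    have "w \<bullet> (t *\<^sub>R y) \<le> dcen_h lam \<alpha> \<gamma> (t *\<^sub>R y)"
      using w(2) by (auto simp: subdifferential_def dcen_h_def dest: spec[of _ "t *\<^sub>R y"])
    also have "\<dots> = t * (lam * \<alpha> * \<gamma> * norm y + t * (lam * (1 - \<gamma>) / 2 * (norm y)\<^sup>2))"
      using t by (simp add: dcen_h_def power2_eq_square field_simps)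
    finally show "w \<bullet> y \<le> lam * \<alpha> * \<gamma> * norm y + t * (lam * (1 - \<gamma>) / 2 * (norm y)\<^sup>2)"
      using t by simp
  qed
  then have 1: "w \<in> subdifferential (\<lambda>y. lam * \<alpha> * \<gamma> * norm y) 0"
    by (simp add: subdifferential_def)
  have "(w + transpose A *v b) \<bullet> y \<le> lam * \<gamma> * l1_norm y" for y
  proof -
    have "w \<bullet> y \<le> lam * \<gamma> * l1_norm y - b \<bullet> (A *v y)"
    proof (rule le_of_le_add_scaled)
      fix t :: real assume t: "t > 0"
      define K where "K = 1/2 * (norm (A *v y))\<^sup>2 + 3 * lam * (1 - \<gamma>) / 2 * (norm y)\<^sup>2"
      have "w \<bullet> (t *\<^sub>R y) \<le> dcen_g A b lam \<gamma> (t *\<^sub>R y) - (norm b)\<^sup>2 / 2"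
        using w(1) by (auto simp: subdifferential_def dcen_g_def[of _ _ _ _ 0] l0 dest: spec[of _ "t *\<^sub>R y"])
      also have "(norm (A *v (t *\<^sub>R y) - b))\<^sup>2 = t\<^sup>2 * (norm (A *v y))\<^sup>2 - 2 * t * (b \<bullet> (A *v y)) + (norm b)\<^sup>2"
        unfolding power2_norm_eq_inner matrix_vector_mult_scaleR
        by (simp add: inner_simps inner_commute algebra_simps power2_eq_square)
      then have "dcen_g A b lam \<gamma> (t *\<^sub>R y) - (norm b)\<^sup>2 / 2
          = t * (lam * \<gamma> * l1_norm y - b \<bullet> (A *v y) + t * K)"
        using t unfolding dcen_g_def K_def l1[OF t] by (simp add: power2_eq_square field_simps)
      finally show "w \<bullet> y \<le> lam * \<gamma> * l1_norm y - b \<bullet> (A *v y) + t * K" using t by simp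
    qed
    then show ?thesis by (simp add: inner_add_left dot_lmul_matrix)
  qed
  then have "w + transpose A *v b \<in> subdifferential (\<lambda>y. lam * \<gamma> * l1_norm y) 0"
    by (simp add: subdifferential_def l0)
  then have "w \<in> (\<lambda>v. - (transpose A *v b) + v) ` subdifferential (\<lambda>y. lam * \<gamma> * l1_norm y) 0"
    by (rule image_eqI[rotated]) simp
  with 1 show ?thesis by blast
qed

section \<open>Descent and location of the DCA iterates\<close>

lemma dca_step_subgradient:
  assumes "dcen_dca_sequence A b lam \<alpha> \<gamma> x"
  shows "lam *\<^sub>R d_l2 \<alpha> \<gamma> (x k) \<in> subdifferential (dcen_g A b lam \<gamma>) (x (Suc k))"
  unfolding subdifferential_def
proof (intro CollectI allI)
  fix y
  have "dcen_g A b lam \<gamma> (x (Suc k)) - lam * (x (Suc k) \<bullet> d_l2 \<alpha> \<gamma> (x k))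
      \<le> dcen_g A b lam \<gamma> y - lam * (y \<bullet> d_l2 \<alpha> \<gamma> (x k))"
  proof (cases "x k = 0")
    case True
    then have "is_arg_min (dcen_g A b lam \<gamma>) (\<lambda>_. True) (x (Suc k))"
      using assms unfolding dcen_dca_sequence_def by metis
    then show ?thesis using True by (auto simp: is_arg_min_def d_l2_def not_less)
  next
    case False
    then have "is_arg_min (\<lambda>y. dcen_g A b lam \<gamma> y - lam * (y \<bullet> d_l2 \<alpha> \<gamma> (x k))) (\<lambda>_. True) (x (Suc k))"
      using assms unfolding dcen_dca_sequence_def by metis
    then show ?thesis by (auto simp: is_arg_min_def not_less)
  qed
  then show "dcen_g A b lam \<gamma> (x (Suc k)) + lam *\<^sub>R d_l2 \<alpha> \<gamma> (x k) \<bullet> (y - x (Suc k)) \<le> dcen_g A b lam \<gamma> y"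
    by (simp add: inner_diff_right inner_commute algebra_simps)
qed

text \<open>The subgradient inequality for g at the new iterate and the strong one for h at the old
  iterate use the same vector, so their linear terms cancel.\<close>

lemma dca_descent:
  assumes par: "0 < \<alpha>" "0 < lam" "0 < \<gamma>" and "dcen_dca_sequence A b lam \<alpha> \<gamma> x"
  shows "dcen_H A b lam \<alpha> \<gamma> (x (Suc k)) + lam * (1 - \<gamma>) / 2 * (norm (x (Suc k) - x k))\<^sup>2
           \<le> dcen_H A b lam \<alpha> \<gamma> (x k)"
proof -
  have "dcen_g A b lam \<gamma> (x (Suc k)) + lam *\<^sub>R d_l2 \<alpha> \<gamma> (x k) \<bullet> (x k - x (Suc k)) \<le> dcen_g A b lam \<gamma> (x k)"
    using dca_step_subgradient[OF assms(4), of k] by (simp add: subdifferential_def)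
  with dcen_h_strong_subgradient[OF par, of "x k" "x (Suc k)"] show ?thesis
    by (simp add: dcen_H_eq_diff inner_diff_right)
qed

text \<open>A subsequence tending to $0$ would, in the limit of the optimality conditions, produce a common
  element of $\partial g(0)$ and $\partial h(0)$.\<close>

lemma dca_away_from_zero:
  fixes A :: "real ^ 'n ^ 'm"
  assumes par: "0 < \<alpha>" "0 < lam" "0 < \<gamma>" "\<gamma> < 1"
    and dca: "dcen_dca_sequence A b lam \<alpha> \<gamma> x"
    and step: "(\<lambda>k. x (Suc k) - x k) \<longlonglongrightarrow> 0"
    and disj: "subdifferential (dcen_g A b lam \<gamma>) 0 \<inter> subdifferential (dcen_h lam \<alpha> \<gamma>) (0 :: real ^ 'n) = {}"
  shows "\<exists>\<rho>>0. \<forall>\<^sub>F k in sequentially. \<rho> \<le> norm (x k)"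
proof (rule ccontr)
  assume "\<not> ?thesis"
  then have "\<not> (\<forall>\<^sub>F k in sequentially. inverse (Suc n) \<le> norm (x k))" for n
    by (metis inverse_positive_iff_positive of_nat_0_less_iff zero_less_Suc)
  then have "\<exists>k\<ge>n. norm (x k) < inverse (Suc n)" for n
    unfolding eventually_sequentially by (meson not_le)
  then obtain \<kappa> where \<kappa>: "\<And>n. \<kappa> n \<ge> n" "\<And>n. norm (x (\<kappa> n)) < inverse (Suc n)"
    by metis
  have x0: "(\<lambda>n. x (\<kappa> n)) \<longlonglongrightarrow> 0"
    using \<kappa>(2) by (intro Lim_null_comparison[OF _ LIMSEQ_inverse_real_of_nat] always_eventually allI)
      (simp add: less_imp_le)
  have "filterlim \<kappa> at_top sequentially"
    by (rule filterlim_at_top_mono[OF filterlim_ident]) (use \<kappa>(1) in auto)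
  then have "(\<lambda>n. x (Suc (\<kappa> n)) - x (\<kappa> n)) \<longlonglongrightarrow> 0"
    using step by (rule filterlim_compose[rotated])
  from tendsto_add[OF this x0] have x1: "(\<lambda>n. x (Suc (\<kappa> n))) \<longlonglongrightarrow> 0" by simp
  \<comment> \<open>Although \<open>d_l2\<close> is discontinuous at 0, it is bounded near 0, which
    yields a limit point w. Each \<open>v n\<close> is a subgradient of h at
    \<open>x (\<kappa> n)\<close> and of g at the next iterate, and both points tend to 0.\<close>
  define v where "v n = lam *\<^sub>R d_l2 \<alpha> \<gamma> (x (\<kappa> n))" for n
  have "norm (v n) \<le> lam * (\<alpha> * \<gamma> + 1)" for n
  proof -
    have "inverse (real (Suc n)) \<le> 1" by (simp add: field_simps)
    with \<kappa>(2)[of n] have "lam * (\<alpha> * \<gamma> + norm (x (\<kappa> n))) \<le> lam * (\<alpha> * \<gamma> + 1)"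
      using par by (intro mult_left_mono) auto
    then show ?thesis using norm_d_l2_le[OF par, of "x (\<kappa> n)"] unfolding v_def by linarith
  qed
  then have "\<forall>n. v n \<in> cball 0 (lam * (\<alpha> * \<gamma> + 1))" by simp
  then obtain w r where r: "strict_mono r" "(v \<circ> r) \<longlonglongrightarrow> w"
    using compact_cball[of 0 "lam * (\<alpha> * \<gamma> + 1)"] unfolding compact_def by blast
  have "w \<in> subdifferential (dcen_g A b lam \<gamma>) 0"
    using continuous_on_dcen_g _ LIMSEQ_subseq_LIMSEQ[OF x1 r(1)] r(2)
    by (rule subdifferential_limit) (simp add: v_def dca_step_subgradient[OF dca])
  moreover have "w \<in> subdifferential (dcen_h lam \<alpha> \<gamma>) 0"
    using continuous_on_dcen_h _ LIMSEQ_subseq_LIMSEQ[OF x0 r(1)] r(2)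
    by (rule subdifferential_limit) (simp add: v_def d_l2_subgradient_dcen_h[OF par])
  ultimately show False using disj by blast
qed

text \<open>Convergence of the sequence is not yet known, so the local inequalities around all
  points of a compact set are combined through a finite subcover into one exponent, with the limit h
  in place of the varying values \<open>H z\<close>.\<close>

lemma lojasiewicz_along_sequence:
  fixes H :: "'a::euclidean_space \<Rightarrow> real"
  assumes S: "compact S" "\<forall>\<^sub>F k in sequentially. y k \<in> S"
    and H: "continuous_on UNIV H" "(\<lambda>k. H (y k)) \<longlonglongrightarrow> h" and u: "u \<longlonglongrightarrow> (0::real)"
    and loj: "\<And>z. z \<in> S \<Longrightarrow> \<forall>\<^sub>F \<eta> in at_right 0. \<forall>k. dist (y k) z < \<eta> \<longrightarrow> u k < \<eta> \<longrightarrow> H (y k) - H z \<le> u k powr (1 + \<eta>)"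
    and u0: "\<And>k. u k \<ge> 0"
  shows "\<exists>\<eta>>0. \<forall>\<^sub>F k in sequentially. H (y k) - h \<le> u k powr (1 + \<eta>)"
proof -
  have loc: "\<exists>\<eta>>0. \<forall>\<^sub>F k in sequentially. dist (y k) z < \<eta> \<longrightarrow> H (y k) - h \<le> u k powr (1 + \<eta>)"
    if z: "z \<in> S" for z
  proof (cases "H z = h")
    case True
    have "\<forall>\<^sub>F \<eta> in at_right (0::real). 0 < \<eta>" by (rule eventually_at_right_less)
    with loj[OF z] have "\<forall>\<^sub>F \<eta> in at_right 0. 0 < \<eta> \<and> (\<forall>k. dist (y k) z < \<eta> \<longrightarrow> u k < \<eta> \<longrightarrow> H (y k) - H z \<le> u k powr (1 + \<eta>))"
      by eventually_elim blast
    then obtain \<eta> where \<eta>: "0 < \<eta>" "\<And>k. dist (y k) z < \<eta> \<Longrightarrow> u k < \<eta> \<Longrightarrow> H (y k) - H z \<le> u k powr (1 + \<eta>)"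
      using eventually_happens'[OF trivial_limit_at_right_real] by blast
    have "\<forall>\<^sub>F k in sequentially. u k < \<eta>" using u \<eta>(1) by (rule order_tendstoD)
    then have "\<forall>\<^sub>F k in sequentially. dist (y k) z < \<eta> \<longrightarrow> H (y k) - h \<le> u k powr (1 + \<eta>)"
      by eventually_elim (use \<eta>(2) True in auto)
    with \<eta>(1) show ?thesis by blast
  next
    case False
    \<comment> \<open>Around a center at another level the claim is vacuous in the long run: the
      values along the sequence approach h, so by continuity the sequence eventually avoids a
      neighborhood of z.\<close>
    define r where "r = \<bar>H z - h\<bar> / 2"
    have r: "r > 0" using False by (simp add: r_def)
    have "isCont H z" using H(1) by (simp add: continuous_on_eq_continuous_at)
    then obtain \<eta> where \<eta>: "\<eta> > 0" "\<And>x. dist x z < \<eta> \<Longrightarrow> dist (H x) (H z) < r"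
      using r unfolding continuous_at_eps_delta dist_norm by blast
    have "\<forall>\<^sub>F k in sequentially. dist (H (y k)) h < r" using H(2) r by (rule tendstoD)
    then have "\<forall>\<^sub>F k in sequentially. dist (y k) z < \<eta> \<longrightarrow> H (y k) - h \<le> u k powr (1 + \<eta>)"
    proof (eventually_elim, intro impI)
      fix k assume "dist (H (y k)) h < r" "dist (y k) z < \<eta>"
      with \<eta>(2)[OF this(2)] have "\<bar>H (y k) - H z\<bar> + \<bar>H (y k) - h\<bar> < \<bar>H z - h\<bar>"
        unfolding r_def dist_real_def by (simp add: field_simps)
      then have False by linarith
      then show "H (y k) - h \<le> u k powr (1 + \<eta>)" ..
    qed
    with \<eta>(1) show ?thesis by blast
  qed
  then have "\<forall>z\<in>S. \<exists>\<eta>>0. \<forall>\<^sub>F k in sequentially. dist (y k) z < \<eta> \<longrightarrow> H (y k) - h \<le> u k powr (1 + \<eta>)"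
    by blast
  from bchoice[OF this] obtain \<eta> where \<eta>: "\<And>z. z \<in> S \<Longrightarrow> \<eta> z > 0"
    "\<And>z. z \<in> S \<Longrightarrow> \<forall>\<^sub>F k in sequentially. dist (y k) z < \<eta> z \<longrightarrow> H (y k) - h \<le> u k powr (1 + \<eta> z)"
    by blast
  have "S \<subseteq> (\<Union>z\<in>S. ball z (\<eta> z))" using \<eta>(1) by force
  then obtain T where T: "T \<subseteq> S" "finite T" "S \<subseteq> (\<Union>z\<in>T. ball z (\<eta> z))"
    using compactE_image[OF S(1), of S "\<lambda>z. ball z (\<eta> z)"] by auto
  have "T \<noteq> {}" using T(3) eventually_happens'[OF sequentially_bot S(2)] by auto
  \<comment> \<open>The least exponent is the weakest requirement once \<open>u k\<close> is below
    1.\<close>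
  define m where "m = Min (\<eta> ` T)"
  have m: "m > 0" "\<And>z. z \<in> T \<Longrightarrow> m \<le> \<eta> z"
    unfolding m_def using T(1,2) \<open>T \<noteq> {}\<close> \<eta>(1) by (auto simp: subset_iff)
  have "\<forall>\<^sub>F k in sequentially. \<forall>z\<in>T. dist (y k) z < \<eta> z \<longrightarrow> H (y k) - h \<le> u k powr (1 + \<eta> z)"
    using T(1,2) \<eta>(2) by (intro eventually_ball_finite) auto
  moreover have "\<forall>\<^sub>F k in sequentially. u k < 1" using u by (rule order_tendstoD) simp
  ultimately have "\<forall>\<^sub>F k in sequentially. H (y k) - h \<le> u k powr (1 + m)"
    using S(2)
  proof eventually_elim
    case (elim k)
    then obtain z where z: "z \<in> T" "dist (y k) z < \<eta> z" using T(3) by (auto simp: dist_commute)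
    then have "H (y k) - h \<le> u k powr (1 + \<eta> z)" using elim(1) by blast
    also have "\<dots> \<le> u k powr (1 + m)"
      using m(2)[OF z(1)] u0[of k] elim(2) by (intro powr_mono') auto
    finally show ?case .
  qed
  with m(1) show ?thesis by blast
qed

theorem theorem21:
  fixes A :: "real ^ 'n ^ 'm" and b :: "real ^ 'm"
    and lam \<alpha> \<gamma> :: real and x :: "nat \<Rightarrow> real ^ 'n"
  assumes "0 < \<alpha>" and "\<alpha> < 1" and "0 < lam" and "0 < \<gamma>" and "\<gamma> < 1"
    and "dcen_dca_sequence A b lam \<alpha> \<gamma> x"
    and "(\<lambda>v. - (transpose A *v b) + v) ` subdifferential (\<lambda>y. lam * \<gamma> * l1_norm y) 0
           \<inter> subdifferential (\<lambda>y. lam * \<alpha> * \<gamma> * norm y) 0 = {}"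
  shows "(\<lambda>k. infdist 0 (dcen_subdiff_H A b lam \<alpha> \<gamma> (x k))) \<longlonglongrightarrow> 0
    \<and> (\<exists>z. x \<longlonglongrightarrow> z \<and> dcen_stationary A b lam \<alpha> \<gamma> z)
    \<and> summable (\<lambda>k. norm (x (Suc k) - x k))"
proof -
  note par = assms(1,3-5) and dca = assms(6)
  define H where "H = dcen_H A b lam \<alpha> \<gamma>"
  define a where "a = lam * (1 - \<gamma>) / 2"
  define v where "v k = lam *\<^sub>R d_l2 \<alpha> \<gamma> (x k)" for k
  have a: "a > 0" using par by (simp add: a_def)
  have v_g: "v k \<in> subdifferential (dcen_g A b lam \<gamma>) (x (Suc k))" for k
    unfolding v_def by (rule dca_step_subgradient[OF dca])
  have v_h: "v k \<in> subdifferential (dcen_h lam \<alpha> \<gamma>) (x k)" for k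
    unfolding v_def by (rule d_l2_subgradient_dcen_h[OF par])
  have descent: "H (x (Suc k)) + a * (norm (x (Suc k) - x k))\<^sup>2 \<le> H (x k)" for k
    unfolding H_def a_def using par dca by (intro dca_descent)
  have H_ge: "2 * a * (norm y)\<^sup>2 \<le> H y" for y
    using dcen_H_coercive[OF assms(1-4), of y A b] by (simp add: H_def a_def)
  have a_sq: "a * (norm y)\<^sup>2 \<ge> 0" for y :: "real ^ 'n" using a by simp
  have H0: "H y \<ge> 0" for y using H_ge[of y] a_sq[of y] by linarith
  have "H (x (Suc k)) \<le> H (x k)" for k
    using descent[of k] a_sq[of "x (Suc k) - x k"] by linarith
  then have dec: "decseq (\<lambda>k. H (x k))" by (simp add: decseq_Suc_iff)
  then obtain h where h: "(\<lambda>k. H (x k)) \<longlonglongrightarrow> h" "\<And>k. h \<le> H (x k)"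
    using H0 by (metis decseq_convergent)
  have step: "(\<lambda>k. x (Suc k) - x k) \<longlonglongrightarrow> 0"
  proof -
    have "(\<lambda>k. (H (x k) - H (x (Suc k))) / a) \<longlonglongrightarrow> (h - h) / a"
      using a h(1) LIMSEQ_Suc[OF h(1)] by (intro tendsto_intros) auto
    then have "(\<lambda>k. (H (x k) - H (x (Suc k))) / a) \<longlonglongrightarrow> 0" by simp
    then have "(\<lambda>k. (norm (x (Suc k) - x k))\<^sup>2) \<longlonglongrightarrow> 0"
      by (rule Lim_null_comparison[rotated])
        (use descent a in \<open>auto intro!: always_eventually simp: field_simps\<close>)
    then show ?thesis by (simp add: tendsto_null_power tendsto_norm_zero_iff)
  qed
  define R where "R = sqrt (H (x 0) / (2 * a))"
  have R: "norm (x k) \<le> R" for k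
  proof -
    have "2 * a * (norm (x k))\<^sup>2 \<le> H (x 0)"
      using H_ge[of "x k"] decseqD[OF dec, of 0 k] by simp
    then have "(norm (x k))\<^sup>2 \<le> H (x 0) / (2 * a)" using a by (simp add: field_simps)
    then show ?thesis unfolding R_def by (rule real_le_rsqrt)
  qed
  have "subdifferential (dcen_g A b lam \<gamma>) 0 \<inter> subdifferential (dcen_h lam \<alpha> \<gamma>) (0 :: real ^ 'n) = {}"
    using dcen_subgradient_at_zero assms(7) by blast
  then obtain \<rho> where \<rho>: "\<rho> > 0" "\<forall>\<^sub>F k in sequentially. \<rho> \<le> norm (x k)"
    using dca_away_from_zero[OF par dca step] by blast
  define L where "L = lam * (2 * \<alpha> * \<gamma> / \<rho> + 1)"
  have "L > 0" using par \<rho>(1) by (simp add: L_def add_pos_pos)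
  \<comment> \<open>The norm of an element of the subdifferential of H at \<open>x (Suc k)\<close>:
    \<open>v k\<close> belongs to g there by optimality of the step, and \<open>v (Suc k)\<close>
    belongs to h.\<close>
  define u where "u k = norm (v k - v (Suc k))" for k
  have uL: "\<forall>\<^sub>F k in sequentially. u k \<le> L * norm (x (Suc k) - x k)"
    using \<rho>(2) eventually_sequentially_Suc[THEN iffD2, OF \<rho>(2)]
  proof eventually_elim
    case (elim k)
    have "u k = lam * norm (d_l2 \<alpha> \<gamma> (x k) - d_l2 \<alpha> \<gamma> (x (Suc k)))"
      using par by (simp add: u_def v_def scaleR_diff_right[symmetric])
    also have "\<dots> \<le> lam * ((2 * \<alpha> * \<gamma> / \<rho> + 1) * norm (x k - x (Suc k)))"
      using par \<rho>(1) elim by (intro mult_left_mono d_l2_lipschitz) auto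
    finally show ?case by (simp add: L_def norm_minus_commute mult.assoc)
  qed
  have "(\<lambda>k. L * norm (x (Suc k) - x k)) \<longlonglongrightarrow> L * norm (0 :: real ^ 'n)"
    by (intro tendsto_intros step)
  then have u: "u \<longlonglongrightarrow> 0"
    by (intro Lim_null_comparison[of u "\<lambda>k. L * norm (x (Suc k) - x k)"]) (use uL in \<open>auto simp: u_def\<close>)
  \<comment> \<open>A compact shell around the origin that contains the tail of the sequence; the
    inequality is available at nonzero points.\<close>
  define S where "S = cball 0 R - ball (0 :: real ^ 'n) \<rho>"
  have "\<exists>\<eta>>0. \<forall>\<^sub>F k in sequentially. H (x (Suc k)) - h \<le> u k powr (1 + \<eta>)"
  proof (rule lojasiewicz_along_sequence[where y = "\<lambda>k. x (Suc k)" and S = S])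
    show "compact S" unfolding S_def by (intro compact_diff compact_cball open_ball)
    show "\<forall>\<^sub>F k in sequentially. x (Suc k) \<in> S"
      using eventually_sequentially_Suc[THEN iffD2, OF \<rho>(2)]
      by eventually_elim (simp add: S_def R)
    show "continuous_on UNIV H" unfolding H_def by (rule continuous_on_dcen_H)
    show "(\<lambda>k. H (x (Suc k))) \<longlonglongrightarrow> h" using LIMSEQ_Suc[OF h(1)] .
    fix z assume "z \<in> S"
    then have "z \<noteq> 0" using \<rho>(1) by (auto simp: S_def)
    from dcen_H_lojasiewicz[OF par this, of A b]
    show "\<forall>\<^sub>F \<eta> in at_right 0. \<forall>k. dist (x (Suc k)) z < \<eta> \<longrightarrow> u k < \<eta> \<longrightarrow>
        H (x (Suc k)) - H z \<le> u k powr (1 + \<eta>)"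
    proof eventually_elim
      case (elim \<eta>)
      then show ?case
        using v_g by (fastforce simp: u_def H_def v_def[of "Suc _"] abs_le_iff)
    qed
  qed (rule u, simp add: u_def)
  then obtain \<eta> where \<eta>: "\<eta> > 0" "\<forall>\<^sub>F k in sequentially. H (x (Suc k)) - h \<le> u k powr (1 + \<eta>)"
    by blast
  have sum: "summable (\<lambda>k. norm (x (Suc k) - x k))"
  proof (rule lojasiewicz_descent_summable[of "\<lambda>k. H (x k) - h", OF _ _ a \<open>L > 0\<close> \<eta>(1)])
    show "\<forall>\<^sub>F k in sequentially. H (x (Suc k)) - h \<le> (L * norm (x (Suc k) - x k)) powr (1 + \<eta>)"
      using \<eta>(2) uL
    proof eventually_elim
      case (elim k)
      have "u k powr (1 + \<eta>) \<le> (L * norm (x (Suc k) - x k)) powr (1 + \<eta>)"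
        using elim(2) \<eta>(1) by (intro powr_mono2) (auto simp: u_def)
      with elim(1) show ?case by linarith
    qed
  qed (use h(2) descent in \<open>auto simp: algebra_simps\<close>)
  have "convergent x"
  proof -
    have "(\<lambda>n. \<Sum>k<n. x (Suc k) - x k) \<longlonglongrightarrow> (\<Sum>k. x (Suc k) - x k)"
      by (rule summable_LIMSEQ[OF summable_norm_cancel[OF sum]])
    then have "(\<lambda>n. x n - x 0 + x 0) \<longlonglongrightarrow> (\<Sum>k. x (Suc k) - x k) + x 0"
      unfolding sum_lessThan_telescope by (intro tendsto_intros)
    then show ?thesis by (auto simp: convergent_def)
  qed
  then obtain z where z: "x \<longlonglongrightarrow> z" by (auto simp: convergent_def)
  have "\<rho> \<le> norm z"
    using tendsto_lowerbound[OF tendsto_norm[OF z] \<rho>(2)] by simp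
  then have z0: "z \<noteq> 0" using \<rho>(1) by auto
  \<comment> \<open>Since the limit is nonzero, \<open>d_l2\<close> is continuous at it, and the
    optimality condition passes to the limit with the same vector in both subdifferentials.\<close>
  have "v \<longlonglongrightarrow> lam *\<^sub>R d_l2 \<alpha> \<gamma> z"
    unfolding v_def d_l2_def using z0 by (intro tendsto_intros z) auto
  then have "lam *\<^sub>R d_l2 \<alpha> \<gamma> z \<in> subdifferential (dcen_g A b lam \<gamma>) z"
    by (rule subdifferential_limit[OF continuous_on_dcen_g v_g LIMSEQ_Suc[OF z]])
  then have "dcen_stationary A b lam \<alpha> \<gamma> z"
    unfolding dcen_stationary_def dcen_subdiff_H_def dc_subdifferential_def
    using d_l2_subgradient_dcen_h[OF par, of z] by force
  \<comment> \<open>The index is shifted because the starting point satisfies no optimality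
    condition; the limit is unaffected.\<close>
  moreover have "(\<lambda>k. infdist 0 (dcen_subdiff_H A b lam \<alpha> \<gamma> (x (Suc k)))) \<longlonglongrightarrow> 0"
  proof (rule Lim_null_comparison[OF always_eventually u], intro allI)
    fix k
    have "v k - v (Suc k) \<in> dcen_subdiff_H A b lam \<alpha> \<gamma> (x (Suc k))"
      unfolding dcen_subdiff_H_def dc_subdifferential_def using v_g v_h by blast
    then show "norm (infdist 0 (dcen_subdiff_H A b lam \<alpha> \<gamma> (x (Suc k)))) \<le> u k"
      using infdist_le[of "v k - v (Suc k)" _ 0] by (simp add: u_def infdist_nonneg)
  qed
  then have "(\<lambda>k. infdist 0 (dcen_subdiff_H A b lam \<alpha> \<gamma> (x k))) \<longlonglongrightarrow> 0"
    by (rule LIMSEQ_imp_Suc)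
  ultimately show ?thesis using z sum by blast
qed

end
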